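(* There are families of 3-CNF formulas $(F_n)_{n\ge 1}$, where $F_n$ has $O(n)$ variables and $O(n)$ clauses, such that every Circular Resolution refutation of $F_n$ has width $\Omega(n)$ and size $2^{\Omega(n)}$.
   Context: Circular Resolution. A literal is a propositional variable $X$ or its negation $\overline{X}$. A clause is a finite set of literals read as a disjunction; $0$ denotes the empty clause. A 3-CNF formula is a set of clauses with at most three literals each; the families in question consist of unsatisfiable formulas. The rules are, for clauses $C$ and variables $X$: axiom (no premises, conclusion $X\vee\overline{X}$); symmetric cut (premises $C\vee X$ and $C\vee\overline{X}$, conclusion $C$); split (premise $C$, two conclusions $C\vee X$ and $C\vee\overline{X}$). A circular pre-proof $\Pi$ is a finite directed bipartite graph with formula-vertices (set $J$), each labelled by a clause (labels may repeat), and inference-vertices (set $I$), each labelled by an instance of a rule whose premises are the labels of its in-neighbours and whose conclusions are the labels of its out-neighbours (one in-neighbour per premise, one out-neighbour per conclusion); cycles are allowed. A flow assignment is a map $F:I\to\mathbb{R}^+$ to the positive reals; the balance of $u\in J$ is $B(u)=\sum_{w\in N^-(u)}F(w)-\sum_{w\in N^+(u)}F(w)$, where $N^-(u),N^+(u)$ are the sets of in- and out-neighbours of $u$. Sources are the formula-vertices of negative balance, sinks those of positive balance. $\Pi$ is a Circular Resolution proof of a clause $A$ from a set of clauses $\mathscr{H}$ if there is a flow assignment for which every source is labelled by a clause in $\mathscr{H}$ and some sink is labelled by $A$. A refutation of $\mathscr{H}$ is a proof of $0$ from $\mathscr{H}$. The size is the sum of the sizes of the clauses labelling formula-vertices (a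 one-literal clause has size $1$; a clause with $k\neq 1$ literals has size $k+1$), and the width is the maximum number of literals in a clause labelling a formula-vertex. *)

theory Defs
  imports Complex_Main "HOL-Library.Landau_Symbols"
begin

datatype literal = Pos nat | Neg nat

fun lit_var :: "literal \<Rightarrow> nat" where
  "lit_var (Pos x) = x"
| "lit_var (Neg x) = x"

fun lit_true :: "(nat \<Rightarrow> bool) \<Rightarrow> literal \<Rightarrow> bool" where
  "lit_true \<alpha> (Pos x) = \<alpha> x"
| "lit_true \<alpha> (Neg x) = (\<not> \<alpha> x)"

text \<open>Clauses are the finite members of this type; the empty clause is the empty set.\<close>

type_synonym clause = "literal set"

definition satisfiable :: "clause set \<Rightarrow> bool" where
  "satisfiable H \<longleftrightarrow> (\<exists>\<alpha>. \<forall>C\<in>H. \<exists>l\<in>C. lit_true \<alpha> l)"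

definition formula_vars :: "clause set \<Rightarrow> nat set" where
  "formula_vars H = lit_var ` \<Union>H"

definition three_cnf :: "clause set \<Rightarrow> bool" where
  "three_cnf H \<longleftrightarrow> finite H \<and> (\<forall>C\<in>H. finite C \<and> card C \<le> 3)"

datatype rule_instance = Axiom nat | Cut clause nat | Split clause nat

fun rule_premises :: "rule_instance \<Rightarrow> clause list" where
  "rule_premises (Axiom x) = []"
| "rule_premises (Cut C x) = [insert (Pos x) C, insert (Neg x) C]"
| "rule_premises (Split C x) = [C]"

fun rule_conclusions :: "rule_instance \<Rightarrow> clause list" where
  "rule_conclusions (Axiom x) = [{Pos x, Neg x}]"
| "rule_conclusions (Cut C x) = [C]"
| "rule_conclusions (Split C x) = [insert (Pos x) C, insert (Neg x) C]"

text \<open>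
  The two sides of the bipartite graph are separate sets of natural numbers, which need not be
  disjoint. Since the graphs are finite, fixing the type of vertices is no restriction.
\<close>

record graph =
  formula_vertices :: "nat set"
  inference_vertices :: "nat set"
  premise_edges :: "(nat \<times> nat) set"    \<comment> \<open>from formula-vertices to inference-vertices\<close>
  conclusion_edges :: "(nat \<times> nat) set"  \<comment> \<open>from inference-vertices to formula-vertices\<close>
  clause_of :: "nat \<Rightarrow> clause"
  rule_of :: "nat \<Rightarrow> rule_instance"

text \<open>
  The distinct lists match premises and conclusions with neighbours one to one. In the degenerate
  case where the two premises of a cut, or the two conclusions of a split, are the same clause,
  they still belong to two different vertices.
\<close>

definition circular_pre_proof :: "graph \<Rightarrow> bool" where
  "circular_pre_proof \<Pi> \<longleftrightarrow>
     finite (formula_vertices \<Pi>) \<and> finite (inference_vertices \<Pi>) \<and>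
     premise_edges \<Pi> \<subseteq> formula_vertices \<Pi> \<times> inference_vertices \<Pi> \<and>
     conclusion_edges \<Pi> \<subseteq> inference_vertices \<Pi> \<times> formula_vertices \<Pi> \<and>
     (\<forall>u\<in>formula_vertices \<Pi>. finite (clause_of \<Pi> u)) \<and>
     (\<forall>w\<in>inference_vertices \<Pi>.
        (\<exists>us. distinct us \<and> set us = {u. (u, w) \<in> premise_edges \<Pi>} \<and>
              map (clause_of \<Pi>) us = rule_premises (rule_of \<Pi> w)) \<and>
        (\<exists>us. distinct us \<and> set us = {u. (w, u) \<in> conclusion_edges \<Pi>} \<and>
              map (clause_of \<Pi>) us = rule_conclusions (rule_of \<Pi> w)))"

definition flow_assignment :: "graph \<Rightarrow> (nat \<Rightarrow> real) \<Rightarrow> bool" where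
  "flow_assignment \<Pi> f \<longleftrightarrow> (\<forall>w\<in>inference_vertices \<Pi>. f w > 0)"

definition balance :: "graph \<Rightarrow> (nat \<Rightarrow> real) \<Rightarrow> nat \<Rightarrow> real" where
  "balance \<Pi> f u =
     (\<Sum>w | (w, u) \<in> conclusion_edges \<Pi>. f w) - (\<Sum>w | (u, w) \<in> premise_edges \<Pi>. f w)"

definition circular_proof :: "graph \<Rightarrow> clause set \<Rightarrow> clause \<Rightarrow> bool" where
  "circular_proof \<Pi> H A \<longleftrightarrow> circular_pre_proof \<Pi> \<and>
     (\<exists>f. flow_assignment \<Pi> f \<and>
        (\<forall>u\<in>formula_vertices \<Pi>. balance \<Pi> f u < 0 \<longrightarrow> clause_of \<Pi> u \<in> H) \<and>
        (\<exists>u\<in>formula_vertices \<Pi>. balance \<Pi> f u > 0 \<and> clause_of \<Pi> u = A))"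

definition circular_refutation :: "graph \<Rightarrow> clause set \<Rightarrow> bool" where
  "circular_refutation \<Pi> H \<longleftrightarrow> circular_proof \<Pi> H {}"

definition clause_size :: "clause \<Rightarrow> nat" where
  "clause_size C = (if card C = 1 then 1 else card C + 1)"

definition proof_size :: "graph \<Rightarrow> nat" where
  "proof_size \<Pi> = (\<Sum>u\<in>formula_vertices \<Pi>. clause_size (clause_of \<Pi> u))"

text \<open>The maximum is meaningful because a proof has a sink, hence at least one formula-vertex.\<close>

definition proof_width :: "graph \<Rightarrow> nat" where
  "proof_width \<Pi> = Max ((\<lambda>u. card (clause_of \<Pi> u)) ` formula_vertices \<Pi>)"

end

theory Submission
  imports Defs
begin

text \<open>
  The hard formulas are inconsistent systems of \<open>n + 1\<close> parity equations in \<open>n\<close> variables, each with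
  at most three variables, whose incidence graph is an expander: any \<open>s \<le> n / 10\<^sup>1\<^sup>0\<close> equations
  together contain at least \<open>7 s / 4\<close> variables. A counting argument provides such a graph.

  For a clause \<open>C\<close> on the variables \<open>S\<close>, let \<open>pe C\<close> be the probability that a uniformly random
  assignment to \<open>S\<close> falsifies \<open>C\<close>, conditioned on all parity constraints on \<open>S\<close> that follow from few
  equations; it is given by its Fourier expansion. The Fourier expansion is additive,
  \<open>pe (C \<or> X) + pe (C \<or> \<not> X) = pe C\<close>, so that inferences preserve it and the flow equations sum up to
  zero, whereas in a refutation of small width the sink contributes a positive and no vertex a
  negative amount.

  For the size, the same argument is applied to \<open>C \<mapsto> pe (C \<or> R)\<close>, where the clause \<open>R\<close> is the negation of
  a partial assignment under which no wide clause survives. The assignment greedily satisfies the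
  literal occurring in most of the surviving wide clauses among those whose variable is not yet
  determined. By expansion only linearly many variables are ever determined, so that each step
  removes a constant fraction of the wide clauses.
\<close>

section \<open>Pseudo-expectations\<close>

text \<open>Regrouped by inference-vertices, the sum consists of \<open>f w\<close> times the
  difference between the \<open>E\<close>-values of the conclusions and of the premises of
  \<open>w\<close>. By \<open>add\<close> and \<open>ax\<close> this difference vanishes for each of
  the three rules.\<close>

lemma sum_balance_eq_zero:
  fixes E :: "clause \<Rightarrow> real"
  assumes pre: "circular_pre_proof \<Pi>"
    and add: "\<And>C x. finite C \<Longrightarrow> E (insert (Pos x) C) + E (insert (Neg x) C) = E C"
    and ax: "\<And>x. E {Pos x, Neg x} = 0"
  shows "(\<Sum>u\<in>formula_vertices \<Pi>. balance \<Pi> f u * E (clause_of \<Pi> u)) = 0"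
proof -
  let ?J = "formula_vertices \<Pi>" and ?I = "inference_vertices \<Pi>"
  let ?P = "premise_edges \<Pi>" and ?Q = "conclusion_edges \<Pi>"
  let ?c = "clause_of \<Pi>"
  have fin: "finite ?J" "finite ?I" and P: "?P \<subseteq> ?J \<times> ?I" and Q: "?Q \<subseteq> ?I \<times> ?J"
    and finc: "\<And>u. u \<in> ?J \<Longrightarrow> finite (?c u)"
    and inference: "\<And>w. w \<in> ?I \<Longrightarrow>
        (\<exists>us. distinct us \<and> set us = {u. (u, w) \<in> ?P} \<and> map ?c us = rule_premises (rule_of \<Pi> w)) \<and>
        (\<exists>us. distinct us \<and> set us = {u. (w, u) \<in> ?Q} \<and> map ?c us = rule_conclusions (rule_of \<Pi> w))"
    using pre unfolding circular_pre_proof_def by blast+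
  have local: "(\<Sum>u | u \<in> ?J \<and> (w, u) \<in> ?Q. E (?c u)) = (\<Sum>u | u \<in> ?J \<and> (u, w) \<in> ?P. E (?c u))"
    if w: "w \<in> ?I" for w
  proof -
    obtain us vs where us: "distinct us" "set us = {u. (u, w) \<in> ?P}"
        "map ?c us = rule_premises (rule_of \<Pi> w)"
      and vs: "distinct vs" "set vs = {u. (w, u) \<in> ?Q}"
        "map ?c vs = rule_conclusions (rule_of \<Pi> w)"
      using inference[OF w] by blast
    have set: "set us = {u. u \<in> ?J \<and> (u, w) \<in> ?P}" "set vs = {u. u \<in> ?J \<and> (w, u) \<in> ?Q}"
      using us(2) vs(2) P Q by auto
    have eq: "(\<Sum>u | u \<in> ?J \<and> (u, w) \<in> ?P. E (?c u)) = sum_list (map E (rule_premises (rule_of \<Pi> w)))"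
      "(\<Sum>u | u \<in> ?J \<and> (w, u) \<in> ?Q. E (?c u)) = sum_list (map E (rule_conclusions (rule_of \<Pi> w)))"
      using sum_list_distinct_conv_sum_set[OF us(1), of "E \<circ> ?c"]
        sum_list_distinct_conv_sum_set[OF vs(1), of "E \<circ> ?c"] us(3) vs(3)
      by (simp_all only: set map_map[symmetric]) (simp_all add: o_def)
    have finp: "finite C" if "C \<in> set (rule_premises (rule_of \<Pi> w))" for C
      using that us(3) set(1) finc by (metis (no_types, lifting) image_iff list.set_map mem_Collect_eq)
    show ?thesis
    proof (cases "rule_of \<Pi> w")
      case (Axiom x)
      then show ?thesis using eq ax by simp
    next
      case (Cut C x)
      then have "finite C" using finp[of "insert (Pos x) C"] by simp
      then show ?thesis using eq Cut add by simp
    next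
      case (Split C x)
      then have "finite C" using finp[of C] by simp
      then show ?thesis using eq Split add by simp
    qed
  qed
  have Qs: "{w. (w, u) \<in> ?Q} = {w. w \<in> ?I \<and> (w, u) \<in> ?Q}" for u using Q by auto
  have Ps: "{w. (u, w) \<in> ?P} = {w. w \<in> ?I \<and> (u, w) \<in> ?P}" for u using P by auto
  have "(\<Sum>u\<in>?J. balance \<Pi> f u * E (?c u))
      = (\<Sum>u\<in>?J. \<Sum>w | w \<in> ?I \<and> (w, u) \<in> ?Q. f w * E (?c u))
      - (\<Sum>u\<in>?J. \<Sum>w | w \<in> ?I \<and> (u, w) \<in> ?P. f w * E (?c u))"
    by (simp add: balance_def Qs Ps left_diff_distrib sum_subtractf sum_distrib_right)
  also have "\<dots> = (\<Sum>w\<in>?I. \<Sum>u | u \<in> ?J \<and> (w, u) \<in> ?Q. f w * E (?c u))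
      - (\<Sum>w\<in>?I. \<Sum>u | u \<in> ?J \<and> (u, w) \<in> ?P. f w * E (?c u))"
    using sum.swap_restrict[OF fin, of "\<lambda>u w. f w * E (?c u)" "\<lambda>u w. (w, u) \<in> ?Q"]
      sum.swap_restrict[OF fin, of "\<lambda>u w. f w * E (?c u)" "\<lambda>u w. (u, w) \<in> ?P"]
    by simp
  also have "\<dots> = 0"
    by (simp add: sum_distrib_left[symmetric] local)
  finally show ?thesis .
qed

text \<open>No term of the sum in \<open>sum_balance_eq_zero\<close> is negative, because a vertex
  of negative balance carries a hypothesis, where \<open>E\<close> is zero. A sink labelled
  \<open>{}\<close> makes the sum positive.\<close>

lemma no_refutation_if_pseudo_expectation:
  fixes E :: "clause \<Rightarrow> real"
  assumes add: "\<And>C x. finite C \<Longrightarrow> E (insert (Pos x) C) + E (insert (Neg x) C) = E C"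
    and ax: "\<And>x. E {Pos x, Neg x} = 0"
    and nonneg: "\<And>u. u \<in> formula_vertices \<Pi> \<Longrightarrow> 0 \<le> E (clause_of \<Pi> u)"
    and hyp: "\<And>u. u \<in> formula_vertices \<Pi> \<Longrightarrow> clause_of \<Pi> u \<in> H \<Longrightarrow> E (clause_of \<Pi> u) = 0"
    and pos: "0 < E {}"
  shows "\<not> circular_refutation \<Pi> H"
proof
  assume "circular_refutation \<Pi> H"
  then obtain f v where pre: "circular_pre_proof \<Pi>"
    and src: "\<And>u. u \<in> formula_vertices \<Pi> \<Longrightarrow> balance \<Pi> f u < 0 \<Longrightarrow> clause_of \<Pi> u \<in> H"
    and v: "v \<in> formula_vertices \<Pi>" "balance \<Pi> f v > 0" "clause_of \<Pi> v = {}"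
    unfolding circular_refutation_def circular_proof_def by blast
  have "0 < (\<Sum>u\<in>formula_vertices \<Pi>. balance \<Pi> f u * E (clause_of \<Pi> u))"
  proof (rule sum_pos2[of _ v])
    show "finite (formula_vertices \<Pi>)" using pre by (simp add: circular_pre_proof_def)
    show "0 < balance \<Pi> f v * E (clause_of \<Pi> v)" using v pos by simp
    show "0 \<le> balance \<Pi> f u * E (clause_of \<Pi> u)" if "u \<in> formula_vertices \<Pi>" for u
      using src[OF that] nonneg[OF that] hyp[OF that] by (cases "balance \<Pi> f u < 0") auto
  qed (use v in auto)
  then show False using sum_balance_eq_zero[OF pre add ax, of f] by simp
qed

definition tautology :: "clause \<Rightarrow> bool" where
  "tautology C \<longleftrightarrow> (\<exists>x. Pos x \<in> C \<and> Neg x \<in> C)"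

lemma in_lit_var_iff: "x \<in> lit_var ` C \<longleftrightarrow> Pos x \<in> C \<or> Neg x \<in> C"
proof
  assume "x \<in> lit_var ` C"
  then obtain l where "l \<in> C" "x = lit_var l" by auto
  then show "Pos x \<in> C \<or> Neg x \<in> C" by (cases l) auto
qed (auto intro: rev_image_eqI)

section \<open>Parity systems on expanders\<close>

definition falsified_clause :: "(nat \<Rightarrow> bool) \<Rightarrow> nat set \<Rightarrow> clause" where
  "falsified_clause \<alpha> X = (\<lambda>x. if \<alpha> x then Neg x else Pos x) ` X"

lemma lit_var_falsified_clause [simp]: "lit_var ` falsified_clause \<alpha> X = X"
proof -
  have "lit_var (if \<alpha> x then Neg x else Pos x) = x" for x by simp
  then show ?thesis by (simp only: falsified_clause_def image_image image_ident)
qed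

lemma not_lit_true_falsified_clause: "l \<in> falsified_clause \<alpha> X \<Longrightarrow> \<not> lit_true \<alpha> l"
  by (auto simp: falsified_clause_def)

text \<open>Identifies the assignment \<open>\<lambda>x. Neg x \<in> C\<close>, at which
  \<open>pe C\<close> evaluates signs, with \<open>\<alpha>\<close> on the variables of an equation
  having a clause inside \<open>C\<close>.\<close>

lemma falsified_clause_value:
  assumes "falsified_clause \<alpha> X \<subseteq> C" "\<not> tautology C" "x \<in> X"
  shows "Neg x \<in> C \<longleftrightarrow> \<alpha> x"
  using assms by (force simp: falsified_clause_def tautology_def)

lemma card_sym_diff:
  assumes "finite X" "finite Y"
  shows "card (sym_diff X Y) + 2 * card (X \<inter> Y) = card X + card Y"
proof -
  have "card (sym_diff X Y) = card (X - Y) + card (Y - X)"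
    using assms by (intro card_Un_disjoint) auto
  moreover have "card X = card (X - Y) + card (X \<inter> Y)"
    using assms by (subst card_Un_disjoint[symmetric]) (auto intro: arg_cong[of _ _ card])
  moreover have "card Y = card (Y - X) + card (X \<inter> Y)"
    using assms by (subst card_Un_disjoint[symmetric]) (auto intro: arg_cong[of _ _ card])
  ultimately show ?thesis by simp
qed

text \<open>Equation \<open>j\<close> has the variables \<open>A j\<close> and the right-hand side
  \<open>b j\<close>. The ratio 7/4 exceeds 3/2, which makes supports large, and also 5/3, the
  density used in \<open>undetermined_variables\<close>.\<close>

locale xor_system =
  fixes m n r :: nat and A :: "nat \<Rightarrow> nat set" and b :: "nat \<Rightarrow> bool"
  assumes A_subset: "\<And>j. j < m \<Longrightarrow> A j \<subseteq> {..<n}"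
    and card_A: "\<And>j. j < m \<Longrightarrow> card (A j) \<le> 3"
    and expansion: "\<And>T. T \<subseteq> {..<m} \<Longrightarrow> T \<noteq> {} \<Longrightarrow> card T \<le> r \<Longrightarrow> 7 * card T \<le> 4 * card (\<Union>(A ` T))"
begin

text \<open>The variables that survive when the equations in \<open>T\<close> are added modulo
  2.\<close>

definition supp :: "nat set \<Rightarrow> nat set" where
  "supp T = {x. odd (card {j\<in>T. x \<in> A j})}"

text \<open>For \<open>j < m\<close> the sign is 1 if \<open>\<alpha>\<close> satisfies equation
  \<open>j\<close> and -1 otherwise, so that adding equations becomes multiplying signs.\<close>

definition eqn_sign :: "(nat \<Rightarrow> bool) \<Rightarrow> nat \<Rightarrow> real" where
  "eqn_sign \<alpha> j = (if b j then -1 else 1) * (\<Prod>x\<in>A j. if \<alpha> x then -1 else 1)"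

definition chi :: "(nat \<Rightarrow> bool) \<Rightarrow> nat set \<Rightarrow> real" where
  "chi \<alpha> T = (\<Prod>j\<in>T. eqn_sign \<alpha> j)"

text \<open>The parity constraints on \<open>S\<close> obtained by adding at most \<open>r\<close>
  equations, each represented by the set of equations added.\<close>

definition small :: "nat set \<Rightarrow> nat set set" where
  "small S = {T. T \<subseteq> {..<m} \<and> card T \<le> r \<and> supp T \<subseteq> S}"

definition formula :: "clause set" where
  "formula = (\<Union>j<m. {falsified_clause \<alpha> (A j) | \<alpha>. eqn_sign \<alpha> j = -1})"

text \<open>The assignment \<open>\<lambda>x. Neg x \<in> C\<close> falsifies \<open>C\<close> unless \<open>C\<close> is a tautology.\<close>

definition pe :: "clause \<Rightarrow> real" where
  "pe C = (if tautology C then 0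
     else (\<Sum>T\<in>small (lit_var ` C). chi (\<lambda>x. Neg x \<in> C) T) / 2 ^ card C)"

section \<open>Calculus of supports and signs\<close>

lemma finite_A: "j < m \<Longrightarrow> finite (A j)"
  using A_subset finite_subset by blast

lemma finite_T: "T \<subseteq> {..<m} \<Longrightarrow> finite T"
  using finite_subset by blast

lemma finite_small: "finite (small S)"
  by (rule finite_subset[of _ "Pow {..<m}"]) (auto simp: small_def)

lemma supp_subset: "supp T \<subseteq> \<Union>(A ` T)"
proof
  fix x assume "x \<in> supp T"
  then have "{j\<in>T. x \<in> A j} \<noteq> {}" by (force simp: supp_def)
  then show "x \<in> \<Union>(A ` T)" by auto
qed

lemma supp_subset_vars: "T \<subseteq> {..<m} \<Longrightarrow> supp T \<subseteq> {..<n}"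
  using supp_subset[of T] A_subset by blast

lemma supp_empty [simp]: "supp {} = {}"
  by (simp add: supp_def)

lemma supp_singleton [simp]: "supp {j} = A j"
proof -
  have "{i \<in> {j}. x \<in> A i} = (if x \<in> A j then {j} else {})" for x by auto
  then show ?thesis by (simp add: supp_def)
qed

lemma supp_sym_diff:
  assumes "finite T" "finite U"
  shows "supp (sym_diff T U) \<subseteq> supp T \<union> supp U"
proof
  fix x assume x: "x \<in> supp (sym_diff T U)"
  let ?c = "\<lambda>T. {j\<in>T. x \<in> A j}"
  have "?c (sym_diff T U) = sym_diff (?c T) (?c U)" by auto
  moreover have "card (sym_diff (?c T) (?c U)) + 2 * card (?c T \<inter> ?c U) = card (?c T) + card (?c U)"
    using assms by (intro card_sym_diff) auto
  ultimately show "x \<in> supp T \<union> supp U"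
    using x by (auto simp: supp_def) presburger
qed

lemma eqn_sign_cases: "eqn_sign \<alpha> j = 1 \<or> eqn_sign \<alpha> j = -1"
proof -
  have "(\<Prod>x\<in>X. if \<alpha> x then -1 else 1) \<in> {1, -1 :: real}" for X
    by (induction X rule: infinite_finite_induct) auto
  then show ?thesis by (auto simp: eqn_sign_def)
qed

lemma chi_cases: "chi \<alpha> T = 1 \<or> chi \<alpha> T = -1"
  unfolding chi_def
proof (induction T rule: infinite_finite_induct)
  case (insert j T)
  then show ?case using eqn_sign_cases[of \<alpha> j] by auto
qed auto

text \<open>Equations in both sets contribute the square of a sign, which is 1.\<close>

lemma chi_sym_diff:
  assumes "finite T" "finite U"
  shows "chi \<alpha> (sym_diff T U) = chi \<alpha> T * chi \<alpha> U"
proof -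
  have T: "chi \<alpha> T = chi \<alpha> (T - U) * chi \<alpha> (T \<inter> U)"
    unfolding chi_def using assms prod.Int_Diff[of T "eqn_sign \<alpha>" U] by simp
  have U: "chi \<alpha> U = chi \<alpha> (U - T) * chi \<alpha> (T \<inter> U)"
    unfolding chi_def using assms prod.Int_Diff[of U "eqn_sign \<alpha>" T] by (simp add: Int_commute)
  have "chi \<alpha> (sym_diff T U) = chi \<alpha> (T - U) * chi \<alpha> (U - T)"
    unfolding chi_def using assms by (subst prod.union_disjoint) auto
  then show ?thesis using T U chi_cases[of \<alpha> "T \<inter> U"] by auto
qed

lemma eqn_sign_flip:
  assumes "finite (A j)"
  shows "eqn_sign (\<alpha>(x := \<not> \<alpha> x)) j = (if x \<in> A j then -1 else 1) * eqn_sign \<alpha> j"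
proof (cases "x \<in> A j")
  case True
  have "(\<Prod>y\<in>A j - {x}. if (\<alpha>(x := \<not> \<alpha> x)) y then -1 else 1 :: real) =
        (\<Prod>y\<in>A j - {x}. if \<alpha> y then -1 else 1)"
    by (rule prod.cong) auto
  then show ?thesis using True assms by (simp add: eqn_sign_def prod.remove[of "A j" x])
next
  case False
  then have "(\<Prod>y\<in>A j. if (\<alpha>(x := \<not> \<alpha> x)) y then -1 else 1 :: real) =
        (\<Prod>y\<in>A j. if \<alpha> y then -1 else 1)"
    by (intro prod.cong) auto
  then show ?thesis using False by (simp add: eqn_sign_def)
qed

text \<open>Flipping \<open>x\<close> changes one sign for each equation of \<open>T\<close>
  containing \<open>x\<close>, so only the parity of their number matters.\<close>

lemma chi_flip:
  assumes "T \<subseteq> {..<m}"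
  shows "chi (\<alpha>(x := \<not> \<alpha> x)) T = (if x \<in> supp T then -1 else 1) * chi \<alpha> T"
proof -
  have "chi (\<alpha>(x := \<not> \<alpha> x)) T = (\<Prod>j\<in>T. (if x \<in> A j then -1 else 1) * eqn_sign \<alpha> j)"
    unfolding chi_def using assms by (intro prod.cong) (auto simp: eqn_sign_flip finite_A)
  also have "\<dots> = (\<Prod>j\<in>T. if x \<in> A j then -1 else 1) * chi \<alpha> T"
    by (simp add: prod.distrib chi_def)
  also have "(\<Prod>j\<in>T. if x \<in> A j then -1 else 1 :: real) = (-1) ^ card {j\<in>T. x \<in> A j}"
    using finite_T[OF assms] by (simp add: prod.If_cases Int_def)
  finally show ?thesis by (simp add: supp_def del: fun_upd_apply)
qed

section \<open>Support bounds from expansion, and the groups \<open>small S\<close>\<close>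

text \<open>Double counting: variables outside the support are covered by at least two equations.\<close>

lemma expansion_supp:
  assumes "T \<subseteq> {..<m}" "card T \<le> r"
  shows "card T \<le> 2 * card (supp T)"
proof (cases "T = {}")
  case False
  let ?N = "\<Union>(A ` T)"
  have fin: "finite T" "finite ?N" using finite_T[OF assms(1)] assms(1) finite_A by auto
  have "(\<Sum>j\<in>T. card {x\<in>?N. x \<in> A j}) = (\<Sum>x\<in>?N. card {j\<in>T. x \<in> A j})"
    using sum.swap_restrict[OF fin, of "\<lambda>_ _. 1::nat" "\<lambda>j x. x \<in> A j"] by simp
  moreover have "(\<Sum>j\<in>T. card {x\<in>?N. x \<in> A j}) \<le> (\<Sum>j\<in>T. 3)"
  proof (rule sum_mono)
    fix j assume "j \<in> T"
    then have "{x\<in>?N. x \<in> A j} = A j" by auto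
    then show "card {x\<in>?N. x \<in> A j} \<le> 3" using card_A assms \<open>j \<in> T\<close> by auto
  qed
  moreover have "(\<Sum>x\<in>?N. 2 - (if x \<in> supp T then 1 else 0)) \<le> (\<Sum>x\<in>?N. card {j\<in>T. x \<in> A j})"
  proof (rule sum_mono)
    fix x assume "x \<in> ?N"
    then have "card {j\<in>T. x \<in> A j} > 0" using fin by (auto simp: card_gt_0_iff)
    then show "2 - (if x \<in> supp T then 1 else 0) \<le> card {j\<in>T. x \<in> A j}"
      by (cases "card {j\<in>T. x \<in> A j} = 1") (auto simp: supp_def)
  qed
  moreover have "(\<Sum>x\<in>?N. 2 - (if x \<in> supp T then 1 else 0)) + card (supp T) = 2 * card ?N"
  proof -
    have "card (supp T) = (\<Sum>x\<in>?N. if x \<in> supp T then 1 else 0)"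
      using fin supp_subset[of T] by (simp add: sum.If_cases Int_absorb1)
    then have "(\<Sum>x\<in>?N. 2 - (if x \<in> supp T then 1 else 0)) + card (supp T)
      = (\<Sum>x\<in>?N. (2 - (if x \<in> supp T then 1 else 0)) + (if x \<in> supp T then 1 else 0))"
      by (simp only: sum.distrib)
    also have "\<dots> = (\<Sum>x\<in>?N. 2)" by (rule sum.cong) simp_all
    finally show ?thesis by simp
  qed
  \<comment> \<open>Expansion bounds \<open>2 * card ?N\<close> from below by 7/2 times
    \<open>card T\<close>, so at least half of \<open>card T\<close> is left for the
    support.\<close>
  ultimately have "2 * card ?N \<le> 3 * card T + card (supp T)" by simp
  then show ?thesis using expansion[OF assms(1) False assms(2)] by simp
qed simp

text \<open>Expansion improves the bound \<open>r\<close> in \<open>small S\<close> to one linear in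
  the number of variables; this gap makes \<open>small S\<close> closed under addition.\<close>

lemma card_small:
  assumes "T \<in> small S"
  shows "card T \<le> 2 * card (S \<inter> {..<n})"
proof -
  have "supp T \<subseteq> S \<inter> {..<n}" using assms supp_subset_vars by (auto simp: small_def)
  then have "card (supp T) \<le> card (S \<inter> {..<n})" by (intro card_mono) auto
  then show ?thesis using expansion_supp[of T] assms by (auto simp: small_def)
qed

text \<open>By \<open>card_small\<close> each summand uses at most half of \<open>r\<close>
  equations, which is where the factor 4 comes from.\<close>

lemma sym_diff_small:
  assumes "4 * card (S \<inter> {..<n}) \<le> r" "T \<in> small S" "U \<in> small S"
  shows "sym_diff T U \<in> small S"
proof -
  have f: "finite T" "finite U" using assms finite_T by (auto simp: small_def)
  have "card (sym_diff T U) \<le> card (T \<union> U)" using f by (intro card_mono) auto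
  also have "\<dots> \<le> card T + card U" by (rule card_Un_le)
  also have "\<dots> \<le> r" using card_small[OF assms(2)] card_small[OF assms(3)] assms(1) by simp
  finally show ?thesis using assms supp_sym_diff[OF f] unfolding small_def by blast
qed

lemma empty_small: "{} \<in> small S"
  by (simp add: small_def)

text \<open>Under symmetric difference, \<open>small S\<close> is a group with character \<open>chi \<alpha>\<close>.\<close>

lemma sum_chi_eq_zero:
  assumes "4 * card (S \<inter> {..<n}) \<le> r" "U \<in> small S" "chi \<alpha> U = -1"
  shows "(\<Sum>T\<in>small S. chi \<alpha> T) = 0"
proof -
  have inv: "sym_diff (sym_diff T U) U = T" for T by auto
  have "(\<Sum>T\<in>small S. chi \<alpha> T) = (\<Sum>T\<in>small S. chi \<alpha> (sym_diff T U))"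
    by (rule sum.reindex_bij_witness[of _ "\<lambda>T. sym_diff T U" "\<lambda>T. sym_diff T U"])
      (use inv sym_diff_small[OF assms(1) _ assms(2)] in auto)
  also have "\<dots> = (\<Sum>T\<in>small S. - chi \<alpha> T)"
    by (rule sum.cong) (use assms finite_T in \<open>auto simp: chi_sym_diff small_def\<close>)
  finally show ?thesis by (simp add: sum_negf)
qed

text \<open>Together with \<open>sum_chi_eq_zero\<close> this is the usual dichotomy: a character
  with values 1 and -1 sums to zero or to the order of the group, hence never to a negative
  number.\<close>

lemma sum_chi_pos:
  assumes "\<And>U. U \<in> small S \<Longrightarrow> chi \<alpha> U \<noteq> -1"
  shows "0 < (\<Sum>T\<in>small S. chi \<alpha> T)"
proof -
  have "chi \<alpha> T = 1" if "T \<in> small S" for T using chi_cases assms that by blast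
  then have "(\<Sum>T\<in>small S. chi \<alpha> T) = card (small S)" by simp
  then show ?thesis using empty_small finite_small by (auto simp: card_gt_0_iff)
qed

section \<open>Properties of the pseudo-expectation\<close>

lemma pe_nonneg:
  assumes "4 * card (lit_var ` C \<inter> {..<n}) \<le> r"
  shows "0 \<le> pe C"
  using sum_chi_pos[of "lit_var ` C"] sum_chi_eq_zero[OF assms] unfolding pe_def
  by (smt (verit) divide_nonneg_pos zero_less_power)

text \<open>For a new variable \<open>x\<close> the two falsifying assignments differ at
  \<open>x\<close>. Terms with \<open>x\<close> in the support cancel, the others occur twice, and
  the extra literal in the denominator absorbs the factor 2.\<close>

lemma pe_add:
  assumes "finite C"
  shows "pe (insert (Pos x) C) + pe (insert (Neg x) C) = pe C"
proof (cases "tautology C")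
  case True
  then have "tautology (insert l C)" for l by (auto simp: tautology_def)
  then show ?thesis using True by (simp add: pe_def)
next
  case nt: False
  consider (pos) "Pos x \<in> C" | (neg) "Neg x \<in> C" | (new) "Pos x \<notin> C" "Neg x \<notin> C" by blast
  then show ?thesis
  proof cases
    case pos
    then have "tautology (insert (Neg x) C)" by (auto simp: tautology_def)
    then show ?thesis using pos by (simp add: insert_absorb pe_def[of "insert (Neg x) C"])
  next
    case neg
    then have "tautology (insert (Pos x) C)" by (auto simp: tautology_def)
    then show ?thesis using neg by (simp add: insert_absorb pe_def[of "insert (Pos x) C"])
  next
    case new
    let ?S = "lit_var ` C" and ?a = "\<lambda>y. Neg y \<in> C"
    have taut: "\<not> tautology (insert (Pos x) C)" "\<not> tautology (insert (Neg x) C)"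
      using nt new by (auto simp: tautology_def)
    have x: "x \<notin> ?S" using new by (simp add: in_lit_var_iff)
    have a: "(\<lambda>y. Neg y \<in> insert (Neg x) C) = ?a(x := \<not> ?a x)" using new by (auto simp: fun_eq_iff)
    have "(\<Sum>T\<in>small (insert x ?S). chi ?a T) + (\<Sum>T\<in>small (insert x ?S). chi (?a(x := \<not> ?a x)) T)
      = (\<Sum>T\<in>small (insert x ?S). if x \<notin> supp T then 2 * chi ?a T else 0)"
      unfolding sum.distrib[symmetric]
    proof (rule sum.cong)
      fix T assume "T \<in> small (insert x ?S)"
      then have "T \<subseteq> {..<m}" by (simp add: small_def)
      from chi_flip[OF this, of ?a x]
      show "chi ?a T + chi (?a(x := \<not> ?a x)) T = (if x \<notin> supp T then 2 * chi ?a T else 0)"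
        by auto
    qed simp
    also have "\<dots> = (\<Sum>T\<in>small ?S. 2 * chi ?a T)"
    proof -
      have "{T \<in> small (insert x ?S). x \<notin> supp T} = small ?S"
        using x by (auto simp: small_def)
      then show ?thesis by (subst sum.inter_filter[symmetric]) (simp_all add: finite_small)
    qed
    finally have "(\<Sum>T\<in>small (insert x ?S). chi ?a T) + (\<Sum>T\<in>small (insert x ?S). chi (?a(x := \<not> ?a x)) T)
      = 2 * (\<Sum>T\<in>small ?S. chi ?a T)" by (simp add: sum_distrib_left)
    then show ?thesis
      unfolding pe_def a using nt taut new assms
      by (simp add: add_divide_distrib[symmetric])
  qed
qed

lemma pe_tautology: "tautology C \<Longrightarrow> pe C = 0"
  by (simp add: pe_def)

text \<open>A nonempty set of at most \<open>r\<close> equations has nonempty support, so only the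
  empty set contributes, and the value is 1.\<close>

lemma pe_empty: "0 < pe {}"
proof -
  have "small {} = {{}}"
  proof (intro equalityI subsetI)
    fix T assume T: "T \<in> small {}"
    then have "finite T" using finite_T by (simp add: small_def)
    then show "T \<in> {{}}" using card_small[OF T] by simp
  qed (use empty_small in simp)
  then show ?thesis by (simp add: pe_def tautology_def chi_def)
qed

text \<open>The assignment falsifying \<open>D\<close> violates some equation \<open>j\<close>, so
  the character is -1 at the group element \<open>{j}\<close>. The superset \<open>D\<close> leaves
  room for a restriction \<open>R\<close>.\<close>

lemma pe_formula:
  assumes "C \<in> formula" "C \<subseteq> D" "4 * card (lit_var ` D \<inter> {..<n}) \<le> r" "0 < r"
  shows "pe D = 0"
proof (cases "tautology D")
  case False
  obtain j \<alpha> where j: "j < m" "C = falsified_clause \<alpha> (A j)" "eqn_sign \<alpha> j = -1"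
    using assms(1) by (auto simp: formula_def)
  have "eqn_sign (\<lambda>x. Neg x \<in> D) j = eqn_sign \<alpha> j"
    unfolding eqn_sign_def using falsified_clause_value[of \<alpha> "A j" D] j(2) assms(2) False
    by (intro arg_cong2[of _ _ _ _ "(*)"] prod.cong) auto
  then have "chi (\<lambda>x. Neg x \<in> D) {j} = -1" using j by (simp add: chi_def)
  moreover have "{j} \<in> small (lit_var ` D)"
    using j assms image_mono[OF assms(2), of lit_var] by (simp add: small_def)
  ultimately show ?thesis
    using sum_chi_eq_zero[OF assms(3)] by (simp add: pe_def)
qed (rule pe_tautology)

text \<open>Adding \<open>R\<close> to every clause preserves additivity, and clauses that turn into
  tautologies get the value 0, so only the surviving ones have to be narrow.\<close>

lemma no_refutation_if_narrow:
  assumes r: "0 < r" and R: "0 < pe R" "finite R"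
    and narrow: "\<And>u. u \<in> formula_vertices \<Pi> \<Longrightarrow>
      tautology (clause_of \<Pi> u \<union> R) \<or> 4 * card (lit_var ` (clause_of \<Pi> u \<union> R) \<inter> {..<n}) \<le> r"
  shows "\<not> circular_refutation \<Pi> formula"
proof (rule no_refutation_if_pseudo_expectation[where E = "\<lambda>C. pe (C \<union> R)"])
  show "pe (insert (Pos x) C \<union> R) + pe (insert (Neg x) C \<union> R) = pe (C \<union> R)" if "finite C" for C x
    using pe_add[of "C \<union> R" x] that R by simp
  show "pe ({Pos x, Neg x} \<union> R) = 0" for x by (rule pe_tautology) (auto simp: tautology_def)
  show "0 \<le> pe (clause_of \<Pi> u \<union> R)" if "u \<in> formula_vertices \<Pi>" for u
    using narrow[OF that] pe_nonneg pe_tautology by fastforce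
  show "pe (clause_of \<Pi> u \<union> R) = 0" if "u \<in> formula_vertices \<Pi>" "clause_of \<Pi> u \<in> formula" for u
    using narrow[OF that(1)] pe_formula[OF that(2) Un_upper1 _ r] pe_tautology by blast
qed (use R in simp)

section \<open>Restrictions that remove wide clauses\<close>

text \<open>
  If a variable outside \<open>K\<close> were determined by \<open>D\<close>, the equations witnessing this
  could be added to a maximal set \<open>I\<close> of equations with few variables outside \<open>D\<close>: all but one
  of their new variables occur in at least two of them.
\<close>

lemma undetermined_variables:
  assumes "finite D" "14 * card D + 2 \<le> r"
  obtains K where "finite K" "D \<subseteq> K" "card K \<le> 21 * card D"
    "\<And>v T. v \<notin> K \<Longrightarrow> T \<in> small (insert v D) \<Longrightarrow> v \<notin> supp T"
proof -
  let ?N = "\<lambda>I. \<Union>(A ` I)"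
  \<comment> \<open>The density 5/3 of variables outside \<open>D\<close> lies below 7/4, which
    bounds such sets, and above 3/2, which leaves room for adding further equations.\<close>
  let ?P = "\<lambda>I. I \<subseteq> {..<m} \<and> card I \<le> r \<and> 3 * card (?N I - D) \<le> 5 * card I"
  have "\<exists>I. ?P I \<and> (\<forall>I'. ?P I' \<longrightarrow> card I' \<le> card I)"
    by (rule ex_has_greatest_nat[of ?P "{}" _ "Suc r"]) auto
  then obtain I where I: "I \<subseteq> {..<m}" "card I \<le> r" "3 * card (?N I - D) \<le> 5 * card I"
    and max: "\<And>I'. ?P I' \<Longrightarrow> card I' \<le> card I" by blast
  have finN: "finite (?N J)" if "J \<subseteq> {..<m}" for J
    using that finite_T finite_A by auto
  \<comment> \<open>The factor 12 is the inverse of the gap 7/4 - 5/3. The total of 21 in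
    \<open>cardK\<close> is then 1 + 12 * 5/3.\<close>
  have cardI: "card I \<le> 12 * card D"
  proof (cases "I = {}")
    case False
    have "card (?N I) \<le> card ((?N I - D) \<union> D)" using assms finN I by (intro card_mono) auto
    also have "\<dots> \<le> card (?N I - D) + card D" by (rule card_Un_le)
    finally show ?thesis using expansion[OF I(1) False I(2)] I(3) by simp
  qed simp
  let ?K = "D \<union> ?N I"
  have cardK: "card ?K \<le> 21 * card D"
  proof -
    have "?K = D \<union> (?N I - D)" by auto
    then have "card ?K \<le> card D + card (?N I - D)" by (metis card_Un_le)
    then show ?thesis using cardI I(3) by simp
  qed
  have "v \<notin> supp T" if v: "v \<notin> ?K" and T: "T \<in> small (insert v D)" for v T
  proof
    assume vT: "v \<in> supp T"
    have Tm: "T \<subseteq> {..<m}" and suppT: "supp T \<subseteq> insert v D" using T by (auto simp: small_def)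
    define T' where "T' = T - I"
    define U where "U = ?N T' - ?K"
    have T'm: "T' \<subseteq> {..<m}" and finT': "finite T'" using Tm finite_T by (auto simp: T'_def)
    have finU: "finite U" using finN[OF T'm] by (simp add: U_def)
    have "v \<in> ?N T" using vT supp_subset by blast
    then have "T' \<noteq> {}" using v by (auto simp: T'_def)
    then have t: "0 < card T'" using finT' by (simp add: card_gt_0_iff)
    have count: "{j\<in>T'. x \<in> A j} = {j\<in>T. x \<in> A j}" if "x \<in> U" for x
      using that by (auto simp: T'_def U_def)
    have pos: "0 < card {j\<in>T'. x \<in> A j}" if "x \<in> U" for x
      using that finT' by (auto simp: U_def card_gt_0_iff)
    \<comment> \<open>Such an \<open>x\<close> lies outside \<open>supp T\<close> and in no equation
      of \<open>I\<close>, so the equations of \<open>T'\<close> containing it are even in number,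
      and there is at least one.\<close>
    have two: "2 \<le> card {j\<in>T'. x \<in> A j}" if "x \<in> U" "x \<noteq> v" for x
    proof -
      have "x \<notin> supp T" using that suppT by (auto simp: U_def)
      then have "even (card {j\<in>T'. x \<in> A j})" using count[OF that(1)] by (simp add: supp_def)
      then show ?thesis using pos[OF that(1)] by presburger
    qed
    have "(\<Sum>x\<in>U. 2 - (if x = v then 1 else 0)) \<le> (\<Sum>x\<in>U. card {j\<in>T'. x \<in> A j})"
    proof (rule sum_mono)
      fix x assume "x \<in> U"
      then show "2 - (if x = v then 1 else 0) \<le> card {j\<in>T'. x \<in> A j}"
        using pos[of x] two[of x] by (cases "x = v") auto
    qed
    moreover have "2 * card U \<le> (\<Sum>x\<in>U. 2 - (if x = v then 1 else 0)) + 1"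
    proof -
      have "2 * card U = (\<Sum>x\<in>U. (2 - (if x = v then 1 else 0)) + (if x = v then 1 else 0))"
        by (subst sum.cong[of U U _ "\<lambda>_. 2"]) auto
      also have "\<dots> = (\<Sum>x\<in>U. 2 - (if x = v then 1 else 0)) + (\<Sum>x\<in>U. if x = v then 1 else 0)"
        by (rule sum.distrib)
      also have "(\<Sum>x\<in>U. if x = v then 1 else 0) \<le> (1::nat)" using finU by simp
      finally show ?thesis by simp
    qed
    moreover have "(\<Sum>x\<in>U. card {j\<in>T'. x \<in> A j}) = (\<Sum>j\<in>T'. card {x\<in>U. x \<in> A j})"
      using sum.swap_restrict[OF finU finT', of "\<lambda>_ _. 1::nat" "\<lambda>x j. x \<in> A j"] by simp
    moreover have "(\<Sum>j\<in>T'. card {x\<in>U. x \<in> A j}) \<le> (\<Sum>j\<in>T'. 3)"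
    proof (rule sum_mono)
      fix j assume "j \<in> T'"
      then have j: "j < m" using T'm by auto
      have "card {x\<in>U. x \<in> A j} \<le> card (A j)" using finite_A[OF j] by (intro card_mono) auto
      then show "card {x\<in>U. x \<in> A j} \<le> 3" using card_A[OF j] by simp
    qed
    ultimately have U2: "2 * card U \<le> 3 * card T' + 1" by simp
    \<comment> \<open>The bound \<open>U2\<close> suffices once \<open>T'\<close> has three
      equations. With one equation no variable except \<open>v\<close> can be covered twice; with
      two, rounding down helps.\<close>
    have "3 * card U \<le> 5 * card T'"
    proof (cases "card T' = 1")
      case True
      have "U \<subseteq> {v}"
      proof
        fix x assume x: "x \<in> U"
        have "card {j\<in>T'. x \<in> A j} \<le> card T'" using finT' by (intro card_mono) auto
        then show "x \<in> {v}" using two[OF x] True by auto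
      qed
      then have "card U \<le> card {v}" by (intro card_mono) auto
      then show ?thesis using True by simp
    next
      case False
      show ?thesis
      proof (cases "card T' = 2")
        case True
        then have "2 * card U \<le> 7" using U2 by simp
        then have "card U \<le> 3" by linarith
        then show ?thesis using True by simp
      next
        case False
        then have "3 \<le> card T'" using t \<open>card T' \<noteq> 1\<close> by linarith
        then show ?thesis using U2 by linarith
      qed
    qed
    moreover have "card (?N (I \<union> T) - D) \<le> card (?N I - D) + card U"
    proof -
      have "card (?N (I \<union> T) - D) \<le> card ((?N I - D) \<union> U)"
        using finU finN[OF I(1)] by (intro card_mono) (auto simp: U_def T'_def)
      also have "\<dots> \<le> card (?N I - D) + card U" by (rule card_Un_le)
      finally show ?thesis .
    qed
    moreover have cardIT: "card (I \<union> T) = card I + card T'"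
    proof -
      have "I \<union> T = I \<union> T'" by (auto simp: T'_def)
      moreover have "card (I \<union> T') = card I + card T'"
        using finite_T[OF I(1)] finT' by (intro card_Un_disjoint) (auto simp: T'_def)
      ultimately show ?thesis by simp
    qed
    \<comment> \<open>The bounds 12 \<open>card D\<close> for \<open>I\<close> and 2
      (\<open>card D\<close> + 1) for \<open>T\<close> add up to the hypothesis on
      \<open>r\<close>.\<close>
    moreover have "card (I \<union> T) \<le> r"
    proof -
      have "card (insert v D \<inter> {..<n}) \<le> card (insert v D)" using assms by (intro card_mono) auto
      also have "\<dots> \<le> card D + 1" using assms by (simp add: card_insert_if)
      finally have "card T \<le> 2 * (card D + 1)" using card_small[OF T] by simp
      moreover have "card (I \<union> T) \<le> card I + card T" by (rule card_Un_le)
      ultimately show ?thesis using cardI assms(2) by simp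
    qed
    ultimately have "?P (I \<union> T)" using I Tm by auto
    from max[OF this] show False using cardIT t by simp
  qed
  then show thesis using that[of ?K] cardK assms finN[OF I(1)] by blast
qed

text \<open>No constraint in the enlarged group involves the new variable, so the group and its
  signs stay the same and \<open>pe\<close> is merely halved.\<close>

lemma pe_insert_pos:
  assumes R: "finite R" "0 < pe R" and l: "lit_var l \<notin> lit_var ` R"
    and free: "\<And>T. T \<in> small (insert (lit_var l) (lit_var ` R)) \<Longrightarrow> lit_var l \<notin> supp T"
  shows "0 < pe (insert l R)"
proof -
  let ?v = "lit_var l" and ?S = "lit_var ` R" and ?a = "\<lambda>x. Neg x \<in> R"
  have new: "Pos ?v \<notin> R" "Neg ?v \<notin> R" using l by (auto simp: in_lit_var_iff)
  have "\<not> tautology R" using R by (auto simp: pe_def)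
  then have taut: "\<not> tautology (insert l R)" using new by (cases l) (auto simp: tautology_def)
  have small: "small (insert ?v ?S) = small ?S" using free by (auto simp: small_def)
  have "chi (\<lambda>x. Neg x \<in> insert l R) T = chi ?a T" if T: "T \<in> small (insert ?v ?S)" for T
  proof (cases l)
    case (Neg x)
    have "(\<lambda>x. Neg x \<in> insert l R) = ?a(?v := \<not> ?a ?v)" using Neg new by (auto simp: fun_eq_iff)
    then show ?thesis using chi_flip[of T ?a ?v] free[OF T] T by (simp add: small_def)
  qed simp
  then have "(\<Sum>T\<in>small (insert ?v ?S). chi (\<lambda>x. Neg x \<in> insert l R) T) = (\<Sum>T\<in>small ?S. chi ?a T)"
    unfolding small[symmetric] by (intro sum.cong) auto
  moreover have "0 < (\<Sum>T\<in>small ?S. chi ?a T)"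
    using R \<open>\<not> tautology R\<close> by (simp add: pe_def zero_less_divide_iff)
  ultimately show ?thesis using taut by (simp add: pe_def)
qed

text \<open>For non-tautological \<open>R\<close>, the first condition says that \<open>C\<close> is
  no tautology and is not satisfied by the partial assignment falsifying \<open>R\<close>.\<close>

definition wide :: "nat \<Rightarrow> clause set \<Rightarrow> clause \<Rightarrow> clause set" where
  "wide w P R = {C\<in>P. \<not> tautology (C \<union> R) \<and> w < card (lit_var ` C \<inter> {..<n})}"

text \<open>Averaging: each clause of \<open>W\<close> contains at least \<open>p\<close> of the at
  most \<open>2 * n\<close> literals on variables outside \<open>K\<close>.\<close>

lemma popular_literal:
  assumes "finite W" "W \<noteq> {}" "finite K" "0 < p"
    and wide: "\<And>C. C \<in> W \<Longrightarrow> p + card K \<le> card (lit_var ` C \<inter> {..<n})"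
  obtains l where "lit_var l \<in> {..<n} - K" "p * card W \<le> 2 * n * card {C\<in>W. l \<in> C}"
proof (rule ccontr)
  assume neg: "\<not> thesis"
  let ?X = "{..<n} - K"
  let ?L = "Pos ` ?X \<union> Neg ` ?X"
  have L: "l \<in> ?L \<longleftrightarrow> lit_var l \<in> ?X" for l by (cases l) auto
  have finL: "finite ?L" by simp
  have "card ?L \<le> card (Pos ` ?X) + card (Neg ` ?X)" by (rule card_Un_le)
  also have "\<dots> \<le> card ?X + card ?X" by (intro add_mono card_image_le) auto
  also have "\<dots> \<le> n + n"
    by (intro add_mono) (metis card_Diff_subset_Int card_lessThan card_mono Diff_subset finite_lessThan)+
  finally have cardL: "card ?L \<le> 2 * n" by simp
  have many: "p \<le> card {l\<in>?L. l \<in> C}" if C: "C \<in> W" for C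
  proof -
    have fin: "finite {l\<in>?L. l \<in> C}" using finL by simp
    have "lit_var ` C \<inter> {..<n} \<subseteq> lit_var ` {l\<in>?L. l \<in> C} \<union> K"
      using L by auto
    then have "card (lit_var ` C \<inter> {..<n}) \<le> card (lit_var ` {l\<in>?L. l \<in> C} \<union> K)"
      using fin assms(3) by (intro card_mono) auto
    also have "\<dots> \<le> card (lit_var ` {l\<in>?L. l \<in> C}) + card K" by (rule card_Un_le)
    also have "\<dots> \<le> card {l\<in>?L. l \<in> C} + card K" using card_image_le[OF fin] by (intro add_right_mono)
    finally show ?thesis using wide[OF C] by simp
  qed
  obtain C where C: "C \<in> W" using assms by blast
  have "{l\<in>?L. l \<in> C} \<noteq> {}" using many[OF C] assms(4) by (metis card.empty not_le)
  then have Lne: "?L \<noteq> {}" by blast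
  have "p * card W = (\<Sum>C\<in>W. p)" by simp
  also have "\<dots> \<le> (\<Sum>C\<in>W. card {l\<in>?L. l \<in> C})" by (rule sum_mono) (rule many)
  also have "\<dots> = (\<Sum>l\<in>?L. card {C\<in>W. l \<in> C})"
    using sum.swap_restrict[OF assms(1) finL, of "\<lambda>_ _. 1::nat" "\<lambda>C l. l \<in> C"] by simp
  finally have "2 * n * (p * card W) \<le> (\<Sum>l\<in>?L. 2 * n * card {C\<in>W. l \<in> C})"
    by (simp add: sum_distrib_left[symmetric])
  also have "\<dots> < (\<Sum>l\<in>?L. p * card W)"
  proof (rule sum_strict_mono[OF finL Lne])
    fix l assume "l \<in> ?L"
    then show "2 * n * card {C\<in>W. l \<in> C} < p * card W" using neg that L by (meson not_le)
  qed
  also have "\<dots> \<le> 2 * n * (p * card W)" using cardL by (simp only: sum_constant of_nat_id mult_le_mono1)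
  finally show False by simp
qed

text \<open>Each greedy step satisfies a popular undetermined literal, which removes a fraction of
  at least p/(2n) of the surviving wide clauses.\<close>

lemma killing_restriction:
  assumes P: "finite P" and k: "14 * k + 2 \<le> r" and p: "0 < p" "p + 21 * k \<le> w + 1" "p \<le> 2 * n"
    and "i \<le> k"
  shows "\<exists>R. finite R \<and> card (lit_var ` R) \<le> i \<and> 0 < pe R \<and>
    real (card (wide w P R)) \<le> (1 - p / (2 * n)) ^ i * card P"
  using \<open>i \<le> k\<close>
proof (induction i)
  case 0
  have "card (wide w P {}) \<le> card P" using P by (intro card_mono) (auto simp: wide_def)
  then show ?case using pe_empty by (intro exI[of _ "{}"]) simp
next
  case (Suc i)
  have q: "0 \<le> 1 - p / (2 * n)" using p by (auto simp: field_simps)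
  obtain R where R: "finite R" "card (lit_var ` R) \<le> i" "0 < pe R"
    and W: "real (card (wide w P R)) \<le> (1 - p / (2 * n)) ^ i * card P"
    using Suc by auto
  show ?case
  proof (cases "wide w P R = {}")
    \<comment> \<open>Nothing is left to remove, so \<open>R\<close> is kept; hence \<open>i\<close>
      is only an upper bound on its number of variables.\<close>
    case True
    then have "real (card (wide w P R)) \<le> (1 - p / (2 * n)) ^ Suc i * card P"
      using zero_le_power[OF q, of "Suc i"] by simp
    then show ?thesis using R by (intro exI[of _ R]) auto
  next
    case False
    have finW: "finite (wide w P R)" using P by (simp add: wide_def)
    obtain K where K: "finite K" "lit_var ` R \<subseteq> K" "card K \<le> 21 * card (lit_var ` R)"
      and free: "\<And>v T. v \<notin> K \<Longrightarrow> T \<in> small (insert v (lit_var ` R)) \<Longrightarrow> v \<notin> supp T"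
    proof (rule undetermined_variables[of "lit_var ` R"])
      show "14 * card (lit_var ` R) + 2 \<le> r" using R(2) Suc.prems k by simp
    qed (use R(1) in auto)
    \<comment> \<open>A wide clause has at least \<open>w + 1\<close> variables, of which at most
      \<open>21 * k\<close> are determined.\<close>
    have wide: "p + card K \<le> card (lit_var ` C \<inter> {..<n})" if "C \<in> wide w P R" for C
      using that K(3) R(2) Suc.prems p(2) by (auto simp: wide_def)
    obtain l where l: "lit_var l \<in> {..<n} - K"
      and many: "p * card (wide w P R) \<le> 2 * n * card {C\<in>wide w P R. l \<in> C}"
      using popular_literal[OF finW False K(1) p(1) wide] by blast
    \<comment> \<open>\<open>R\<close> is the negation of the assignment, so satisfying
      \<open>l\<close> means adding its complement to \<open>R\<close>.\<close>
    obtain l' where l': "lit_var l' = lit_var l" "\<And>C. l \<in> C \<Longrightarrow> tautology (insert l' C)"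
    proof (cases l)
      case (Pos x)
      then show thesis using that[of "Neg x"] by (auto simp: tautology_def)
    next
      case (Neg x)
      then show thesis using that[of "Pos x"] by (auto simp: tautology_def)
    qed
    have "0 < pe (insert l' R)"
      using R l l' K free by (intro pe_insert_pos) auto
    moreover have "card (lit_var ` insert l' R) \<le> Suc i"
      using R by (simp add: card_insert_if)
    moreover have "real (card (wide w P (insert l' R))) \<le> (1 - p / (2 * n)) ^ Suc i * card P"
    proof -
      let ?W = "wide w P R" and ?W' = "{C\<in>wide w P R. l \<in> C}"
      have "wide w P (insert l' R) \<subseteq> ?W - ?W'"
        using l'(2) by (auto simp: wide_def tautology_def)
      then have "card (wide w P (insert l' R)) \<le> card (?W - ?W')" using finW by (intro card_mono) auto
      also have "\<dots> = card ?W - card ?W'" using finW by (intro card_Diff_subset) auto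
      finally have "real (card (wide w P (insert l' R))) \<le> real (card ?W) - real (card ?W')"
        using card_mono[OF finW, of ?W'] by auto
      moreover have "real p * card ?W \<le> 2 * n * card ?W'"
        using many by (metis of_nat_le_iff of_nat_mult of_nat_numeral)
      then have "p / (2 * n) * card ?W \<le> card ?W'"
        using l by (simp add: field_simps)
      ultimately have "real (card (wide w P (insert l' R))) \<le> (1 - p / (2 * n)) * card ?W"
        by (simp add: algebra_simps)
      also have "\<dots> \<le> (1 - p / (2 * n)) * ((1 - p / (2 * n)) ^ i * card P)"
        using W q by (rule mult_left_mono)
      finally show ?thesis by simp
    qed
    ultimately show ?thesis using R(1) by (intro exI[of _ "insert l' R"]) simp
  qed
qed

section \<open>Width and size lower bounds\<close>

lemma width_lower_bound:
  assumes "0 < r" "circular_refutation \<Pi> formula"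
  shows "r < 4 * proof_width \<Pi>"
proof (rule ccontr)
  assume neg: "\<not> r < 4 * proof_width \<Pi>"
  have pre: "circular_pre_proof \<Pi>"
    using assms by (simp add: circular_refutation_def circular_proof_def)
  have "4 * card (lit_var ` (clause_of \<Pi> u \<union> {}) \<inter> {..<n}) \<le> r" if u: "u \<in> formula_vertices \<Pi>" for u
  proof -
    have fin: "finite (clause_of \<Pi> u)" "finite (formula_vertices \<Pi>)"
      using pre u by (simp_all add: circular_pre_proof_def)
    have "card (lit_var ` clause_of \<Pi> u \<inter> {..<n}) \<le> card (lit_var ` clause_of \<Pi> u)"
      using fin by (intro card_mono) auto
    also have "\<dots> \<le> card (clause_of \<Pi> u)" using fin by (intro card_image_le)
    also have "\<dots> \<le> proof_width \<Pi>"
      unfolding proof_width_def using fin u by (intro Max_ge) auto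
    finally show ?thesis using neg by simp
  qed
  then show False using no_refutation_if_narrow[OF assms(1) pe_empty, of \<Pi>] assms(2) by blast
qed

text \<open>If no wide clause survived, every non-tautological \<open>C \<union> R\<close> would
  have at most \<open>w + k\<close> variables below \<open>n\<close>, which is narrow. So at least
  one of the distinct labels survives.\<close>

lemma size_lower_bound:
  assumes k: "14 * k + 2 \<le> r" "4 * (w + k) \<le> r" and p: "0 < p" "p + 21 * k \<le> w + 1" "p \<le> 2 * n"
    and ref: "circular_refutation \<Pi> formula"
  shows "1 \<le> (1 - p / (2 * n)) ^ k * proof_size \<Pi>"
proof -
  let ?J = "formula_vertices \<Pi>" and ?P = "clause_of \<Pi> ` formula_vertices \<Pi>"
  have pre: "circular_pre_proof \<Pi>"
    using ref by (simp add: circular_refutation_def circular_proof_def)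
  then have finJ: "finite ?J" and finc: "\<And>u. u \<in> ?J \<Longrightarrow> finite (clause_of \<Pi> u)"
    by (simp_all add: circular_pre_proof_def)
  have "card ?P \<le> card ?J" using finJ by (rule card_image_le)
  also have "\<dots> = (\<Sum>u\<in>?J. 1)" by simp
  also have "\<dots> \<le> proof_size \<Pi>"
    unfolding proof_size_def by (rule sum_mono) (simp add: clause_size_def)
  finally have size: "card ?P \<le> proof_size \<Pi>" .
  obtain R where R: "finite R" "card (lit_var ` R) \<le> k" "0 < pe R"
    and W: "real (card (wide w ?P R)) \<le> (1 - p / (2 * n)) ^ k * card ?P"
    using killing_restriction[OF finite_imageI[OF finJ] k(1) p order_refl] by blast
  have "wide w ?P R \<noteq> {}"
  proof
    assume empty: "wide w ?P R = {}"
    have "\<not> circular_refutation \<Pi> formula"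
    proof (rule no_refutation_if_narrow[OF _ R(3,1)])
      fix u assume u: "u \<in> ?J"
      show "tautology (clause_of \<Pi> u \<union> R) \<or> 4 * card (lit_var ` (clause_of \<Pi> u \<union> R) \<inter> {..<n}) \<le> r"
      proof (rule disjCI)
        assume neg: "\<not> 4 * card (lit_var ` (clause_of \<Pi> u \<union> R) \<inter> {..<n}) \<le> r"
        have "card (lit_var ` (clause_of \<Pi> u \<union> R) \<inter> {..<n})
          \<le> card ((lit_var ` clause_of \<Pi> u \<inter> {..<n}) \<union> lit_var ` R)"
          using R(1) by (intro card_mono) auto
        also have "\<dots> \<le> card (lit_var ` clause_of \<Pi> u \<inter> {..<n}) + card (lit_var ` R)"
          by (rule card_Un_le)
        finally have "w < card (lit_var ` clause_of \<Pi> u \<inter> {..<n})" using neg R(2) k(2) by simp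
        then show "tautology (clause_of \<Pi> u \<union> R)" using empty u by (auto simp: wide_def)
      qed
    qed (use k in simp)
    then show False using ref by simp
  qed
  moreover have "finite (wide w ?P R)" using finJ by (simp add: wide_def)
  ultimately have "1 \<le> real (card (wide w ?P R))" by (simp add: Suc_le_eq card_gt_0_iff)
  also note W
  also have "(1 - p / (2 * n)) ^ k * card ?P \<le> (1 - p / (2 * n)) ^ k * proof_size \<Pi>"
    using size p by (intro mult_left_mono zero_le_power) (auto simp: field_simps)
  finally show ?thesis .
qed

section \<open>The formula as an unsatisfiable 3-CNF of linear size\<close>

lemma card_formula: "finite formula" "card formula \<le> 64 * m"
  and three_cnf_formula: "three_cnf formula"
  and formula_vars_subset: "formula_vars formula \<subseteq> {..<n}"
proof -
  let ?B = "\<lambda>j. {falsified_clause \<alpha> (A j) | \<alpha>. eqn_sign \<alpha> j = -1}"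
  have B: "finite (?B j)" "card (?B j) \<le> 64" if j: "j < m" for j
  proof -
    let ?L = "Pos ` A j \<union> Neg ` A j"
    \<comment> \<open>There are at most six literals on the variables of an equation, which gives
      the crude bound 2^6 = 64.\<close>
    have sub: "?B j \<subseteq> Pow ?L" by (auto simp: falsified_clause_def)
    have finL: "finite ?L" using finite_A[OF j] by simp
    have "card ?L \<le> card (Pos ` A j) + card (Neg ` A j)" by (rule card_Un_le)
    also have "\<dots> \<le> card (A j) + card (A j)" using finite_A[OF j] by (intro add_mono card_image_le)
    also have "\<dots> \<le> 6" using card_A[OF j] by simp
    finally have "card ?L \<le> 6" .
    have "card (?B j) \<le> card (Pow ?L)" using finL sub by (intro card_mono) auto
    also have "\<dots> = 2 ^ card ?L" using finL by (rule card_Pow)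
    also have "\<dots> \<le> 2 ^ 6" using \<open>card ?L \<le> 6\<close> by (intro power_increasing) auto
    finally show "card (?B j) \<le> 64" by simp
    show "finite (?B j)" using finite_subset[OF sub] finL by simp
  qed
  show fin: "finite formula" unfolding formula_def using B(1) by blast
  have "card formula \<le> (\<Sum>j<m. card (?B j))" unfolding formula_def by (rule card_UN_le) simp
  also have "\<dots> \<le> (\<Sum>j<m. 64)" using B(2) by (intro sum_mono) auto
  finally show "card formula \<le> 64 * m" by simp
  have "finite C \<and> card C \<le> 3" if C: "C \<in> formula" for C
  proof -
    obtain j \<alpha> where j: "j < m" "C = falsified_clause \<alpha> (A j)" using C by (auto simp: formula_def)
    have "card C \<le> card (A j)"
      unfolding j(2) falsified_clause_def using finite_A[OF j(1)] by (rule card_image_le)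
    then show ?thesis using finite_A[OF j(1)] card_A[OF j(1)] j(2) by (simp add: falsified_clause_def)
  qed
  then show "three_cnf formula" using fin by (simp add: three_cnf_def)
  have "lit_var ` C \<subseteq> {..<n}" if "C \<in> formula" for C
    proof -
    obtain j \<alpha> where "j < m" "C = falsified_clause \<alpha> (A j)" using \<open>C \<in> formula\<close> by (auto simp: formula_def)
    then show ?thesis using A_subset by simp
  qed
  then show "formula_vars formula \<subseteq> {..<n}" by (fastforce simp: formula_vars_def)
qed

lemma unsatisfiable_formula:
  assumes "\<And>\<alpha>. \<exists>j<m. eqn_sign \<alpha> j = -1"
  shows "\<not> satisfiable formula"
  unfolding satisfiable_def
proof
  assume "\<exists>\<alpha>. \<forall>C\<in>formula. \<exists>l\<in>C. lit_true \<alpha> l"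
  then obtain \<alpha> where \<alpha>: "\<And>C. C \<in> formula \<Longrightarrow> \<exists>l\<in>C. lit_true \<alpha> l" by blast
  obtain j where "j < m" "eqn_sign \<alpha> j = -1" using assms by blast
  then have "falsified_clause \<alpha> (A j) \<in> formula" by (auto simp: formula_def)
  then show False using \<alpha> not_lit_true_falsified_clause by blast
qed

end

text \<open>There are more right-hand sides than assignments.\<close>

lemma inconsistent_right_hand_side:
  fixes m n :: nat
  assumes "\<And>j. j < m \<Longrightarrow> A j \<subseteq> {..<n}" "n < m"
  shows "\<exists>b. \<forall>\<alpha>. \<exists>j<m. (if b j then -1 else 1) * (\<Prod>x\<in>A j. if \<alpha> x then -1 else 1) = (-1 :: real)"
proof -
  let ?v = "\<lambda>\<alpha> j. (\<Prod>x\<in>A j. if \<alpha> x then -1 else 1) :: real"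
  let ?f = "\<lambda>X. {j. j < m \<and> ?v (\<lambda>x. x \<in> X) j = -1}"
  have sq: "(\<Prod>x\<in>X. if \<alpha> x then -1 else 1 :: real) \<in> {1, -1}" for X :: "nat set" and \<alpha>
    by (induction X rule: infinite_finite_induct) auto
  have "card (?f ` Pow {..<n}) \<le> card (Pow {..<n})" by (rule card_image_le) simp
  also have "\<dots> < card (Pow {..<m})" using assms(2) by (simp add: card_Pow)
  finally have "\<not> Pow {..<m} \<subseteq> ?f ` Pow {..<n}" using card_mono[of "?f ` Pow {..<n}" "Pow {..<m}"] by (auto simp del: card_Pow)
  \<comment> \<open>The left-hand sides of no assignment evaluate to \<open>B\<close>, so
    \<open>B\<close> serves as right-hand side.\<close>
  then obtain B where B: "B \<subseteq> {..<m}" "B \<notin> ?f ` Pow {..<n}" by blast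
  have "\<exists>j<m. (if j \<in> B then -1 else 1) * ?v \<alpha> j = -1" for \<alpha>
  proof (rule ccontr)
    assume neg: "\<not> ?thesis"
    let ?X = "{x. x < n \<and> \<alpha> x}"
    have "j \<in> B \<longleftrightarrow> j < m \<and> ?v (\<lambda>x. x \<in> ?X) j = -1" for j
    proof (cases "j < m")
      case True
      have "?v (\<lambda>x. x \<in> ?X) j = ?v \<alpha> j" using assms(1)[OF True] by (intro prod.cong) auto
      moreover have "(if j \<in> B then -1 else 1) * ?v \<alpha> j \<noteq> -1" using True neg by blast
      ultimately show ?thesis using True sq[of \<alpha> "A j"] by (cases "j \<in> B") auto
    qed (use B in auto)
    then have "B = ?f ?X" by auto
    then show False using B(2) by blast
  qed
  then show ?thesis by (intro exI[of _ "\<lambda>j. j \<in> B"]) blast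
qed

section \<open>Existence of expanders\<close>

lemma power_div_fact_le_exp:
  fixes x :: real
  assumes "0 \<le> x"
  shows "x ^ k / fact k \<le> exp x"
proof -
  have "(\<Sum>i\<in>{k}. x ^ i /\<^sub>R fact i) \<le> exp x"
    unfolding exp_def using assms by (intro sum_le_suminf summable_exp_generic) auto
  then show ?thesis by (simp add: divide_inverse mult.commute)
qed

text \<open>A single term of the exponential series gives k^k / k! \<le> e^k \<le> 3^k.\<close>

lemma binomial_le_power:
  assumes "0 < k"
  shows "real (n choose k) \<le> (3 * real n / real k) ^ k"
proof -
  have "real k ^ k / fact k \<le> exp (real k)" by (rule power_div_fact_le_exp) simp
  also have "exp (real k) = exp 1 ^ k" by (metis exp_of_nat_mult mult.right_neutral)
  also have "\<dots> \<le> 3 ^ k" using exp_le by (intro power_mono) auto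
  finally have k: "real k ^ k \<le> 3 ^ k * fact k" by (simp add: field_simps)
  have "real (n choose k) * fact k \<le> real n ^ k"
    using binomial_fact_pow[of n k] by (metis of_nat_fact of_nat_le_iff of_nat_mult of_nat_power)
  then have "real (n choose k) * fact k * real k ^ k \<le> real n ^ k * (3 ^ k * fact k)"
    using k by (intro mult_mono) auto
  then have "real (n choose k) * real k ^ k \<le> (3 * real n) ^ k"
    by (simp add: power_mult_distrib mult.assoc mult.left_commute mult.commute[of "3 ^ k"])
  then show ?thesis using assms by (simp add: power_divide field_simps)
qed

text \<open>Comparing fourth powers keeps the exponents integral.\<close>

lemma union_bound_term:
  fixes n s :: nat
  defines "q \<equiv> 7 * s div 4"
  assumes "0 < s" "10 ^ 10 * s \<le> n"
  shows "real (Suc n choose s) * real (n choose q) * (q / n) ^ (3 * s) \<le> (1 / 3) ^ s"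
proof -
  define x where "x = real s / n"
  have n: "0 < n" and q: "0 < q" "4 * q \<le> 7 * s" "q \<le> 2 * s" "q \<le> n"
    using assms by (auto simp: q_def)
  have x: "0 < x" "10 ^ 10 * x \<le> 1"
  proof -
    show "0 < x" using assms n by (simp add: x_def)
    have "real (10 ^ 10 * s) \<le> real n" using assms(3) by (rule of_nat_mono)
    then show "10 ^ 10 * x \<le> 1" using n by (simp add: x_def field_simps)
  qed
  define y where "y = real q / n"
  have y: "0 < y" "y \<le> 1" "y \<le> 2 * x"
  proof -
    have "real q \<le> 2 * real s" "real q \<le> real n" using q by linarith+
    then show "0 < y" "y \<le> 1" "y \<le> 2 * x" using q n by (auto simp: y_def x_def field_simps)
  qed
  let ?P = "(6 / x) ^ s * 3 ^ q * y ^ (3 * s - q)"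
  have "real (Suc n choose s) * real (n choose q) * (q / n) ^ (3 * s) \<le> (6 / x) ^ s * (3 / y) ^ q * y ^ (3 * s)"
  proof (intro mult_mono)
    have "real (Suc n choose s) \<le> (3 * real (Suc n) / real s) ^ s" by (rule binomial_le_power) fact
    also have "\<dots> \<le> (6 / x) ^ s"
      using n assms by (intro power_mono) (auto simp: x_def field_simps)
    finally show "real (Suc n choose s) \<le> (6 / x) ^ s" .
    show "real (n choose q) \<le> (3 / y) ^ q"
      using binomial_le_power[OF q(1), of n] n q by (simp add: y_def)
  qed (use x y in \<open>auto simp: y_def\<close>)
  also have "\<dots> = ?P"
  proof -
    have "y ^ (3 * s) = y ^ q * y ^ (3 * s - q)"
      unfolding power_add[symmetric] using q by simp
    then show ?thesis using y by (simp add: power_divide)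
  qed
  also have "?P \<le> (1 / 3) ^ s"
  proof -
    have "?P ^ 4 = (6 / x) ^ (s * 4) * 3 ^ (q * 4) * y ^ ((3 * s - q) * 4)"
      by (simp only: power_mult_distrib power_mult)
    also have "\<dots> = (6 / x) ^ (4 * s) * 3 ^ (4 * q) * y ^ (12 * s - 4 * q)"
      by (simp add: mult.commute[of _ 4] diff_mult_distrib2)
    also have "\<dots> = ((6 / x) ^ 4) ^ s * 3 ^ (4 * q) * y ^ (12 * s - 4 * q)"
      by (simp only: power_mult)
    \<comment> \<open>Since 4q \<le> 7s, the exponent of \<open>y\<close> is at least 5s, against 4s
      factors 1/x; one factor \<open>x\<close> per equation is gained.\<close>
    also have "\<dots> \<le> ((6 / x) ^ 4) ^ s * 3 ^ (7 * s) * (2 * x) ^ (5 * s)"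
    proof (intro mult_mono)
      show "(3::real) ^ (4 * q) \<le> 3 ^ (7 * s)" using q by (intro power_increasing) auto
      have "y ^ (12 * s - 4 * q) \<le> y ^ (5 * s)" using q y by (intro power_decreasing) auto
      also have "\<dots> \<le> (2 * x) ^ (5 * s)" using y by (intro power_mono) auto
      finally show "y ^ (12 * s - 4 * q) \<le> (2 * x) ^ (5 * s)" .
    qed (use x y in auto)
    also have "\<dots> = ((6 / x) ^ 4 * 3 ^ 7 * (2 * x) ^ 5) ^ s"
      by (simp only: power_mult_distrib power_mult)
    \<comment> \<open>The threshold \<open>10 ^ 10\<close> exceeds 81 * 90699264, so the remaining
      factor is at most (1/3)^4.\<close>
    also have "(6 / x) ^ 4 * 3 ^ 7 * (2 * x) ^ 5 = 90699264 * x"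
    proof -
      have "(6 / x) ^ 4 * 3 ^ 7 * (2 * x) ^ 5 = 6 ^ 4 * 3 ^ 7 * 2 ^ 5 * (x ^ 5 / x ^ 4)"
        by (simp add: power_divide power_mult_distrib)
      also have "x ^ 5 / x ^ 4 = x" using x(1) power_diff[of x 4 5] by simp
      finally show ?thesis by simp
    qed
    also have "(90699264 * x) ^ s \<le> ((1 / 3) ^ 4) ^ s"
      using x by (intro power_mono) (auto simp: power_divide)
    also have "\<dots> = ((1 / 3) ^ s) ^ 4"
      by (simp only: mult.commute flip: power_mult)
    finally have "?P ^ 4 \<le> ((1 / 3) ^ s) ^ 4" .
    then show ?thesis using x y by (subst (asm) power_mono_iff) auto
  qed
  finally show ?thesis .
qed

lemma sum_power_third: "(\<Sum>s=1..r. (1 / 3 :: real) ^ s) = (1 - (1 / 3) ^ r) / 2"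
proof (induction r)
  case (Suc r)
  then have "(\<Sum>s=1..Suc r. (1 / 3 :: real) ^ s) = (1 - (1 / 3) ^ r) / 2 + (1 / 3) ^ r / 3" by simp
  then show ?case by simp
qed simp

lemma card_lists_nth_le:
  assumes "\<And>j. j < m \<Longrightarrow> finite (B j)"
  shows "finite {xs. length xs = m \<and> (\<forall>j<m. xs ! j \<in> B j)}"
    and "card {xs. length xs = m \<and> (\<forall>j<m. xs ! j \<in> B j)} \<le> (\<Prod>j<m. card (B j))"
proof -
  let ?S = "\<lambda>m. {xs. length xs = m \<and> (\<forall>j<m. xs ! j \<in> B j)}"
  have "finite (?S m) \<and> card (?S m) \<le> (\<Prod>j<m. card (B j))" using assms
  proof (induction m)
    case (Suc m)
    let ?app = "\<lambda>(xs, x). xs @ [x]"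
    have sub: "?S (Suc m) \<subseteq> ?app ` (?S m \<times> B m)"
    proof
      fix ys assume ys: "ys \<in> ?S (Suc m)"
      then obtain xs x where [simp]: "ys = xs @ [x]" and len: "length xs = m"
        by (auto simp: length_Suc_conv_rev)
      have "xs ! j \<in> B j" if "j < m" for j
      proof -
        have "ys ! j \<in> B j" using ys that by simp
        then show ?thesis using that len by (simp add: nth_append)
      qed
      moreover have "x \<in> B m" using ys len by force
      ultimately show "ys \<in> ?app ` (?S m \<times> B m)" using len by force
    qed
    have IH: "finite (?S m)" "card (?S m) \<le> (\<Prod>j<m. card (B j))" and fin: "finite (B m)"
      using Suc by auto
    have fin': "finite (?S m \<times> B m)" using IH(1) fin by (rule finite_cartesian_product)
    have "card (?S (Suc m)) \<le> card (?S m \<times> B m)"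
      using sub fin' by (rule surj_card_le[rotated])
    also have "\<dots> \<le> (\<Prod>j<m. card (B j)) * card (B m)"
      using IH(2) by (simp only: card_cartesian_product mult_le_mono1)
    finally show ?case using finite_subset[OF sub finite_imageI[OF fin']] by simp
  qed simp
  then show "finite (?S m)" "card (?S m) \<le> (\<Prod>j<m. card (B j))" by blast+
qed

text \<open>A union bound, phrased as counting: among all lists of \<open>Suc n\<close> triples of
  variables, at most half have a set \<open>T\<close> whose triples lie in too small a set
  \<open>R\<close>. Entries of a triple may coincide.\<close>

lemma expander_exists:
  fixes n :: nat
  assumes "0 < n"
  shows "\<exists>A. (\<forall>j<Suc n. A j \<subseteq> {..<n} \<and> card (A j) \<le> 3) \<and>
    (\<forall>T\<subseteq>{..<Suc n}. T \<noteq> {} \<longrightarrow> card T \<le> n div 10 ^ 10 \<longrightarrow> 7 * card T \<le> 4 * card (\<Union>(A ` T)))"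
proof (rule ccontr)
  assume neg: "\<not> ?thesis"
  let ?r = "n div 10 ^ 10" and ?m = "Suc n"
  let ?X = "{..<n} \<times> {..<n} \<times> {..<n}"
  let ?F = "{f. set f \<subseteq> ?X \<and> length f = ?m}"
  let ?v = "\<lambda>t :: nat \<times> nat \<times> nat. {fst t, fst (snd t), snd (snd t)}"
  let ?q = "\<lambda>s :: nat. 7 * s div 4"
  let ?B = "\<lambda>T R. {f. length f = ?m \<and> (\<forall>j<?m. f ! j \<in> (if j \<in> T then R \<times> R \<times> R else ?X))}"
  let ?S = "\<lambda>k s. {T. T \<subseteq> {..<k} \<and> card T = s} :: nat set set"
  have finS: "finite (?S k s)" for k s by simp
  have cardB: "finite (?B T R) \<and> card (?B T R) \<le> (?q s ^ 3) ^ s * (n ^ 3) ^ (?m - s)"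
    if "T \<in> ?S ?m s" "R \<in> ?S n (?q s)" for T R s
  proof -
    have T: "T \<subseteq> {..<?m}" "card T = s" "finite T" and R: "card R = ?q s" "finite R"
      using that finite_subset[of T "{..<?m}"] finite_subset[of R "{..<n}"] by auto
    have fin: "finite (if j \<in> T then R \<times> R \<times> R else ?X)" for j using R by simp
    have "finite (?B T R)" by (rule card_lists_nth_le(1)) (rule fin)
    have "card (?B T R) \<le> (\<Prod>j<?m. card (if j \<in> T then R \<times> R \<times> R else ?X))"
      by (rule card_lists_nth_le(2)) (rule fin)
    also have "(\<Prod>j<?m. card (if j \<in> T then R \<times> R \<times> R else ?X)) = (\<Prod>j<?m. if j \<in> T then ?q s ^ 3 else n ^ 3)"
      by (rule prod.cong) (auto simp: card_cartesian_product R power3_eq_cube)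
    also have "\<dots> = (?q s ^ 3) ^ s * (n ^ 3) ^ (?m - s)"
      using T prod.If_cases[of "{..<?m}" "\<lambda>j. j \<in> T" "\<lambda>_. ?q s ^ 3" "\<lambda>_. n ^ 3"]
      by (simp add: Int_absorb1 card_Diff_subset del: prod.lessThan_Suc lessThan_Suc flip: Diff_eq)
    finally show ?thesis using \<open>finite (?B T R)\<close> by blast
  qed
  have "?F \<subseteq> (\<Union>s\<in>{1..?r}. \<Union>T\<in>?S ?m s. \<Union>R\<in>?S n (?q s). ?B T R)"
  proof
    fix f assume f: "f \<in> ?F"
    have fj: "f ! j \<in> ?X" if "j < ?m" for j using f that nth_mem[of j f] by auto
    let ?A = "\<lambda>j. ?v (f ! j)"
    have A: "?A j \<subseteq> {..<n} \<and> card (?A j) \<le> 3" if "j < ?m" for j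
      using fj[OF that] by (auto simp: card_insert_if)
    have "\<not> (\<forall>T\<subseteq>{..<?m}. T \<noteq> {} \<longrightarrow> card T \<le> ?r \<longrightarrow> 7 * card T \<le> 4 * card (\<Union>(?A ` T)))"
    proof
      assume exp: "\<forall>T\<subseteq>{..<?m}. T \<noteq> {} \<longrightarrow> card T \<le> ?r \<longrightarrow> 7 * card T \<le> 4 * card (\<Union>(?A ` T))"
      show False
        by (rule notE[OF neg], rule exI[of _ ?A], rule conjI[OF _ exp], intro allI impI, rule A)
    qed
    then obtain T where T: "T \<subseteq> {..<?m}" "T \<noteq> {}" "card T \<le> ?r" "4 * card (\<Union>(?A ` T)) < 7 * card T"
      by (simp only: not_all not_imp not_le) (elim exE conjE, rule that)
    let ?s = "card T" and ?N = "\<Union>(?A ` T)"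
    have N: "?N \<subseteq> {..<n}" using T(1) fj by fastforce
    have s: "1 \<le> ?s" using T(1,2) finite_subset by (fastforce simp: Suc_le_eq card_gt_0_iff)
    \<comment> \<open>Failure of expansion is strict, so rounding down loses nothing; enlarging
      \<open>?N\<close> to exactly this size leaves fewer kinds of bad events to count.\<close>
    have q: "card ?N \<le> ?q ?s" "?q ?s \<le> n" using T(3,4) by auto
    obtain R where R: "?N \<subseteq> R" "R \<subseteq> {..<n}" "card R = ?q ?s"
      using exists_subset_between[OF q(1) _ N] q(2) by auto
    have "f ! j \<in> R \<times> R \<times> R" if "j \<in> T" for j
    proof -
      have "?A j \<subseteq> R" using R(1) that by blast
      then show ?thesis by (simp add: mem_Times_iff)
    qed
    then have fB: "f \<in> ?B T R" using f fj by simp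
    have sr: "?s \<in> {1..?r}" and TS: "T \<in> ?S ?m ?s" and RS: "R \<in> ?S n (?q ?s)"
      using s T(1,3) R(2,3) by simp_all
    show "f \<in> (\<Union>s\<in>{1..?r}. \<Union>T\<in>?S ?m s. \<Union>R\<in>?S n (?q s). ?B T R)"
      by (rule UN_I[OF sr], rule UN_I[OF TS], rule UN_I[OF RS], rule fB)
  qed
  moreover have finB: "finite (\<Union>s\<in>{1..?r}. \<Union>T\<in>?S ?m s. \<Union>R\<in>?S n (?q s). ?B T R)"
    using cardB finS by (intro finite_UN_I) auto
  ultimately have "card ?F \<le> card (\<Union>s\<in>{1..?r}. \<Union>T\<in>?S ?m s. \<Union>R\<in>?S n (?q s). ?B T R)"
    by (intro card_mono)
  also have "\<dots> \<le> (\<Sum>s=1..?r. \<Sum>T\<in>?S ?m s. \<Sum>R\<in>?S n (?q s). card (?B T R))"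
    by (intro order.trans[OF card_UN_le] sum_mono finS finite_atLeastAtMost order_refl)
  also have "\<dots> \<le> (\<Sum>s=1..?r. \<Sum>T\<in>?S ?m s. \<Sum>R\<in>?S n (?q s). (?q s ^ 3) ^ s * (n ^ 3) ^ (?m - s))"
    using cardB by (intro sum_mono) blast
  also have "\<dots> = (\<Sum>s=1..?r. (?m choose s) * (n choose ?q s) * ((?q s ^ 3) ^ s * (n ^ 3) ^ (?m - s)))"
    by (simp add: n_subsets mult.assoc del: binomial_Suc_Suc)
  finally have "real (card ?F)
      \<le> real (\<Sum>s=1..?r. (?m choose s) * (n choose ?q s) * ((?q s ^ 3) ^ s * (n ^ 3) ^ (?m - s)))"
    by (rule of_nat_mono)
  also have "\<dots> = (\<Sum>s=1..?r. real (?m choose s) * real (n choose ?q s) *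
      ((real (?q s) ^ 3) ^ s * (real n ^ 3) ^ (?m - s)))"
    by (simp only: of_nat_sum of_nat_mult of_nat_power)
  \<comment> \<open>After division by the total number of lists, the summand is the one in
    \<open>union_bound_term\<close>.\<close>
  also have "\<dots> \<le> (\<Sum>s=1..?r. (1 / 3) ^ s * (real n ^ 3) ^ ?m)"
  proof (rule sum_mono)
    fix s assume s: "s \<in> {1..?r}"
    have "10 ^ 10 * s \<le> 10 ^ 10 * ?r" using s by (intro mult_le_mono2) auto
    also have "\<dots> \<le> n" by simp
    finally have s': "10 ^ 10 * s \<le> n" .
    have "(real n ^ 3) ^ ?m = (real n ^ 3) ^ s * (real n ^ 3) ^ (?m - s)"
      unfolding power_add[symmetric] using s' by simp
    moreover have "(real (?q s) ^ 3) ^ s = (?q s / n) ^ (3 * s) * (real n ^ 3) ^ s"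
      using assms by (simp add: power_divide power_mult)
    ultimately have "real (?m choose s) * real (n choose ?q s) * ((real (?q s) ^ 3) ^ s * (real n ^ 3) ^ (?m - s))
      = real (?m choose s) * real (n choose ?q s) * (?q s / n) ^ (3 * s) * (real n ^ 3) ^ ?m"
      by (simp only: mult_ac)
    also have "\<dots> \<le> (1 / 3) ^ s * (real n ^ 3) ^ ?m"
      using union_bound_term[OF _ s'] s by (intro mult_right_mono) auto
    finally show "real (?m choose s) * real (n choose ?q s) * ((real (?q s) ^ 3) ^ s * (real n ^ 3) ^ (?m - s))
      \<le> (1 / 3) ^ s * (real n ^ 3) ^ ?m" .
  qed
  also have "\<dots> = (1 - (1 / 3) ^ ?r) / 2 * (real n ^ 3) ^ ?m"
    unfolding sum_distrib_right[symmetric] sum_power_third ..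
  also have "\<dots> \<le> 1 / 2 * (real n ^ 3) ^ ?m" by (intro mult_right_mono) auto
  finally have "real (card ?F) \<le> 1 / 2 * (real n ^ 3) ^ ?m" .
  moreover have "real (card ?F) = (real n ^ 3) ^ ?m"
    by (simp add: card_lists_length_eq card_cartesian_product power3_eq_cube mult.assoc)
  moreover have "0 < (real n ^ 3) ^ ?m" using assms by simp
  ultimately show False by linarith
qed

section \<open>Hard formulas\<close>

lemma hard_formula_exists:
  fixes n :: nat
  assumes n: "10 ^ 14 \<le> n"
  shows "\<exists>H. three_cnf H \<and> \<not> satisfiable H \<and> card (formula_vars H) \<le> n \<and> card H \<le> 128 * n \<and>
    (\<forall>\<Pi>. circular_refutation \<Pi> H \<longrightarrow> 1 / 10 ^ 11 * real n \<le> real (proof_width \<Pi>) \<and>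
      2 powr (1 / 10 ^ 26 * real n) \<le> real (proof_size \<Pi>))"
proof -
  define r where "r = n div 10 ^ 10"
  have n0: "0 < n" using n by simp
  obtain A where A: "\<forall>j<Suc n. A j \<subseteq> {..<n} \<and> card (A j) \<le> 3"
    "\<forall>T\<subseteq>{..<Suc n}. T \<noteq> {} \<longrightarrow> card T \<le> r \<longrightarrow> 7 * card T \<le> 4 * card (\<Union>(A ` T))"
    using expander_exists[OF n0] unfolding r_def by (elim exE conjE)
  have A_sub: "A j \<subseteq> {..<n}" if "j < Suc n" for j using A(1) that by blast
  obtain b where b: "\<forall>\<alpha>. \<exists>j<Suc n. (if b j then -1 else 1) * (\<Prod>x\<in>A j. if \<alpha> x then -1 else 1) = (-1 :: real)"
  proof -
    have "\<exists>b. \<forall>\<alpha>. \<exists>j<Suc n. (if b j then -1 else 1) * (\<Prod>x\<in>A j. if \<alpha> x then -1 else 1) = (-1 :: real)"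
      by (rule inconsistent_right_hand_side[OF _ lessI]) (rule A_sub)
    then show thesis using that by (elim exE)
  qed
  interpret xor_system "Suc n" n r A b
  proof
    show "A j \<subseteq> {..<n}" "card (A j) \<le> 3" if "j < Suc n" for j using A(1) that by blast+
    show "7 * card T \<le> 4 * card (\<Union>(A ` T))" if "T \<subseteq> {..<Suc n}" "T \<noteq> {}" "card T \<le> r" for T
      using A(2) that by blast
  qed
  \<comment> \<open>About 21r/1000 variables get determined, well below the width r/8, so
    \<open>p\<close> is at least r/16. As \<open>r\<close> is at least \<open>10 ^ 4\<close>,
    rounding is harmless.\<close>
  define k w where "k = r div 1000" and "w = r div 8"
  define p where "p = w + 1 - 21 * k"
  have r: "10 ^ 4 \<le> r" "r \<le> n" "n \<le> 2 * 10 ^ 10 * r"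
  proof -
    have "10 ^ 10 * r \<le> n" "n < 10 ^ 10 + 10 ^ 10 * r"
      unfolding r_def by (simp_all only: times_div_less_eq_dividend dividend_less_times_div zero_less_power zero_less_numeral)
    then show "10 ^ 4 \<le> r" "r \<le> n" "n \<le> 2 * 10 ^ 10 * r" using n by simp_all
  qed
  have k0: "1000 * k \<le> r" "r < 1000 + 1000 * k" and w0: "8 * w \<le> r" "r < 8 + 8 * w"
    unfolding k_def w_def by (simp_all only: times_div_less_eq_dividend dividend_less_times_div zero_less_numeral)
  have k: "r \<le> 2000 * k" "14 * k + 2 \<le> r" "4 * (w + k) \<le> r"
    using r(1) k0 w0 by simp_all
  have p: "r \<le> 16 * p" "p + 21 * k \<le> w + 1" "0 < p" "p \<le> 2 * n"
    using r k0 w0 unfolding p_def by simp_all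
  \<comment> \<open>Here n \<le> 2 * 10^10 r and r < 4 \<open>proof_width\<close> combine to a
    factor 8 * 10^10.\<close>
  have width: "1 / 10 ^ 11 * real n \<le> real (proof_width \<Pi>)" if "circular_refutation \<Pi> formula" for \<Pi>
    using width_lower_bound[OF _ that] r by simp
  have size: "2 powr (1 / 10 ^ 26 * real n) \<le> real (proof_size \<Pi>)" if "circular_refutation \<Pi> formula" for \<Pi>
  proof -
    let ?x = "real p / real (2 * n)"
    have x: "0 \<le> 1 - ?x" using p n0 by (simp add: field_simps)
    have "1 \<le> (1 - ?x) ^ k * proof_size \<Pi>"
      using size_lower_bound[OF k(2,3) p(3,2,4) that] .
    also have "\<dots> \<le> exp (- ?x) ^ k * proof_size \<Pi>"
      using x exp_ge_add_one_self[of "- ?x"] by (intro mult_right_mono power_mono) auto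
    also have "exp (- ?x) ^ k = exp (- (k * ?x))" by (simp add: exp_of_nat_mult[symmetric])
    finally have "exp (k * ?x) \<le> proof_size \<Pi>"
      by (simp add: exp_minus field_simps)
    moreover have "1 / 10 ^ 26 * real n \<le> k * ?x"
    proof -
      \<comment> \<open>Both \<open>k\<close> and \<open>p\<close> are linear in \<open>n\<close>,
        so the exponent kp/(2n) is linear as well.\<close>
      have "n * n \<le> (2 * 10 ^ 10 * r) * (2 * 10 ^ 10 * r)" using r(3) by (intro mult_mono) auto
      also have "\<dots> = 4 * 10 ^ 20 * (r * r)" by simp
      also have "r * r \<le> (2000 * k) * (16 * p)" using k(1) p(1) by (intro mult_mono) auto
      finally have "n * n \<le> 128 * 10 ^ 23 * (k * p)" by simp
      then have "real (n * n) \<le> real (128 * 10 ^ 23 * (k * p))" by (rule of_nat_mono)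
      then have "2 * (real n * real n) \<le> 2 * (128 * 10 ^ 23) * (real k * real p)" by simp
      also have "\<dots> \<le> 10 ^ 26 * (real k * real p)" by (intro mult_right_mono) auto
      finally have "2 * (real n * real n) \<le> 10 ^ 26 * (real k * real p)" .
      then show ?thesis using n0 by (simp add: field_simps)
    qed
    moreover have "2 powr (1 / 10 ^ 26 * real n) \<le> exp (1 / 10 ^ 26 * real n)"
    proof -
      have "1 / 10 ^ 26 * real n * ln 2 \<le> 1 / 10 ^ 26 * real n * 1"
        using ln_le_minus_one[of "2::real"] by (intro mult_left_mono) auto
      then show ?thesis by (simp add: powr_def)
    qed
    ultimately show ?thesis by (meson exp_le_cancel_iff order.trans)
  qed
  have "\<not> satisfiable formula"
    by (rule unsatisfiable_formula) (use b in \<open>simp add: eqn_sign_def\<close>)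
  moreover have "card (formula_vars formula) \<le> n"
    using card_mono[OF _ formula_vars_subset] by simp
  moreover have "card formula \<le> 128 * n" using card_formula(2) n0 by simp
  ultimately show ?thesis using three_cnf_formula width size by blast
qed

theorem corollary3:
  "\<exists>F :: nat \<Rightarrow> clause set.
     (\<forall>n\<ge>1. three_cnf (F n) \<and> \<not> satisfiable (F n)) \<and>
     (\<lambda>n. real (card (formula_vars (F n)))) \<in> O(\<lambda>n. real n) \<and>
     (\<lambda>n. real (card (F n))) \<in> O(\<lambda>n. real n) \<and>
     (\<exists>c>0. \<forall>\<^sub>F n in sequentially. \<forall>\<Pi>. circular_refutation \<Pi> (F n) \<longrightarrow>
        real (proof_width \<Pi>) \<ge> c * real n) \<and>
     (\<exists>c>0. \<forall>\<^sub>F n in sequentially. \<forall>\<Pi>. circular_refutation \<Pi> (F n) \<longrightarrow>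
        real (proof_size \<Pi>) \<ge> 2 powr (c * real n))"
proof -
  obtain G where G: "\<And>n. 10 ^ 14 \<le> n \<Longrightarrow> three_cnf (G n) \<and> \<not> satisfiable (G n) \<and>
      card (formula_vars (G n)) \<le> n \<and> card (G n) \<le> 128 * n \<and>
      (\<forall>\<Pi>. circular_refutation \<Pi> (G n) \<longrightarrow> 1 / 10 ^ 11 * real n \<le> real (proof_width \<Pi>) \<and>
        2 powr (1 / 10 ^ 26 * real n) \<le> real (proof_size \<Pi>))"
    using hard_formula_exists by metis
  \<comment> \<open>Below the threshold the formula consists of the empty clause, which is
    unsatisfiable; the asymptotic claims ignore these \<open>n\<close>.\<close>
  define F where "F = (\<lambda>n :: nat. if 10 ^ 14 \<le> n then G n else {{}})"
  have large: "\<forall>\<^sub>F n in sequentially. 10 ^ 14 \<le> n" by (rule eventually_ge_at_top)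
  have "three_cnf (F n) \<and> \<not> satisfiable (F n)" for n
    using G[of n] by (auto simp: F_def three_cnf_def satisfiable_def)
  moreover have "(\<lambda>n. real (card (formula_vars (F n)))) \<in> O(\<lambda>n. real n)"
    using large by (intro bigoI[of _ 1] eventually_mono[OF large]) (use G in \<open>auto simp: F_def\<close>)
  moreover have "(\<lambda>n. real (card (F n))) \<in> O(\<lambda>n. real n)"
  proof (intro bigoI[of _ 128] eventually_mono[OF large])
    fix n :: nat assume n: "10 ^ 14 \<le> n"
    then have "card (F n) \<le> 128 * n" using G[OF n] by (simp add: F_def)
    then have "real (card (F n)) \<le> real (128 * n)" by (rule of_nat_mono)
    then show "norm (real (card (F n))) \<le> 128 * norm (real n)" by simp
  qed
  moreover have "\<forall>\<^sub>F n in sequentially. \<forall>\<Pi>. circular_refutation \<Pi> (F n) \<longrightarrow>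
      real (proof_width \<Pi>) \<ge> 1 / 10 ^ 11 * real n"
    by (rule eventually_mono[OF large]) (use G in \<open>auto simp: F_def\<close>)
  moreover have "\<forall>\<^sub>F n in sequentially. \<forall>\<Pi>. circular_refutation \<Pi> (F n) \<longrightarrow>
      real (proof_size \<Pi>) \<ge> 2 powr (1 / 10 ^ 26 * real n)"
    by (rule eventually_mono[OF large]) (use G in \<open>auto simp: F_def\<close>)
  moreover have "(0::real) < 1 / 10 ^ 11" "(0::real) < 1 / 10 ^ 26" by simp_all
  ultimately show ?thesis by blast
qed

end
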